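(* Let $H_1,\ldots,H_k$ be non-bipartite graphs and $r^*:=r^*(H_1,\ldots,H_k)$. For every $\varepsilon>0$ there exists $\delta>0$ such that the following holds for all sufficiently large $n$: if a colouring $\phi:\binom{[n]}{2}\to[k]$ satisfies $$\mathrm{nim}(\phi;H_1,\ldots,H_k)\ge \left(1-\frac1{r^*}\right)\frac{n^2}{2}-\delta n^2,$$ then $\delta_{\mathrm{edit}}(G^{\mathrm{nim}},T(n,r^* ))\le\varepsilon n^2$, where $G^{\mathrm{nim}}$ is the spanning subgraph of $K_n$ on $[n]$ whose edges are the NIM-edges of $\phi$.
   Context: For a $k$-edge-colouring $\phi$ of $K_n$, an edge is a NIM-edge if for no $i\in[k]$ it is contained in a copy of $H_i$ all of whose edges have colour $i$; $\mathrm{nim}(\phi;H_1,\ldots,H_k)$ is the number of NIM-edges. A colouring $\xi:\binom{[r]}{\le 2}\to[k]$ (on subsets of $[r]$ of size at most 2) is feasible if (P1) for each $i\in[k]$ there is no homomorphism from $H_i$ to the graph on $[r]$ formed by the pairs of $\xi$-colour $i$, and (P2) $\xi(\{a,b\})\ne\xi(\{a\})$ for all distinct $a,b\in[r]$; $r^*(H_1,\ldots,H_k)$ is the largest $r$ admitting a feasible colouring. $T(n,r)$ is the Turán graph. The edit distance $\delta_{\mathrm{edit}}(G,H)$ between graphs of the same order is $\min_\sigma|E(G)\triangle\sigma(E(H))|$ over bijections $\sigma:V(H)\to V(G)$. *)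

theory Defs
  imports "HOL-Analysis.Analysis" "HOL-Library.Ramsey"
begin

type_synonym 'a sgraph = "'a set \<times> 'a set set"

abbreviation verts :: "'a sgraph \<Rightarrow> 'a set" where
  "verts G \<equiv> fst G"

abbreviation edges :: "'a sgraph \<Rightarrow> 'a set set" where
  "edges G \<equiv> snd G"

definition finite_simple_graph :: "'a sgraph \<Rightarrow> bool" where
  "finite_simple_graph G \<longleftrightarrow> finite (verts G) \<and> edges G \<subseteq> nsets (verts G) 2"

definition bipartite :: "'a sgraph \<Rightarrow> bool" where
  "bipartite G \<longleftrightarrow>
     (\<exists>A B. A \<union> B = verts G \<and> A \<inter> B = {} \<and> (\<forall>e\<in>edges G. e \<inter> A \<noteq> {} \<and> e \<inter> B \<noteq> {}))"

text \<open>The target of a homomorphism has only two-element edges, so the endpoints of an edge are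
  never identified.\<close>
definition graph_hom :: "('a \<Rightarrow> 'b) \<Rightarrow> 'a sgraph \<Rightarrow> 'b sgraph \<Rightarrow> bool" where
  "graph_hom f G G' \<longleftrightarrow> f \<in> verts G \<rightarrow> verts G' \<and> (\<forall>e\<in>edges G. f ` e \<in> edges G')"

definition graph_iso :: "('a \<Rightarrow> 'b) \<Rightarrow> 'a sgraph \<Rightarrow> 'b sgraph \<Rightarrow> bool" where
  "graph_iso f G G' \<longleftrightarrow> bij_betw f (verts G) (verts G') \<and> (\<lambda>e. f ` e) ` edges G = edges G'"

text \<open>A copy is a not necessarily induced subgraph isomorphic to the given graph.\<close>
definition copy_in :: "'b sgraph \<Rightarrow> 'a sgraph \<Rightarrow> 'b sgraph \<Rightarrow> bool" where
  "copy_in F H G \<longleftrightarrow>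
     verts F \<subseteq> verts G \<and> edges F \<subseteq> edges G \<and> (\<exists>f. graph_iso f H F)"

definition complete_graph :: "nat \<Rightarrow> nat sgraph" where
  "complete_graph n = ({1..n}, nsets {1..n} 2)"

text \<open>The parts are the residue classes modulo \<open>r\<close>, whose sizes in \<open>{1..n}\<close> differ by at most one.\<close>
definition turan_graph :: "nat \<Rightarrow> nat \<Rightarrow> nat sgraph" where
  "turan_graph n r =
     ({1..n}, {{a, b} | a b. a \<in> {1..n} \<and> b \<in> {1..n} \<and> a mod r \<noteq> b mod r})"

definition edge_colouring :: "nat \<Rightarrow> nat \<Rightarrow> (nat set \<Rightarrow> nat) \<Rightarrow> bool" where
  "edge_colouring n k \<phi> \<longleftrightarrow> \<phi> \<in> nsets {1..n} 2 \<rightarrow> {1..k}"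

definition nim_edge ::
  "nat \<Rightarrow> nat \<Rightarrow> (nat \<Rightarrow> 'a sgraph) \<Rightarrow> (nat set \<Rightarrow> nat) \<Rightarrow> nat set \<Rightarrow> bool" where
  "nim_edge n k H \<phi> e \<longleftrightarrow>
     e \<in> edges (complete_graph n) \<and>
     \<not> (\<exists>i\<in>{1..k}. \<exists>F. copy_in F (H i) (complete_graph n) \<and> e \<in> edges F \<and>
          (\<forall>d\<in>edges F. \<phi> d = i))"

definition nim_graph ::
  "nat \<Rightarrow> nat \<Rightarrow> (nat \<Rightarrow> 'a sgraph) \<Rightarrow> (nat set \<Rightarrow> nat) \<Rightarrow> nat sgraph" where
  "nim_graph n k H \<phi> = ({1..n}, {e. nim_edge n k H \<phi> e})"

definition nim :: "nat \<Rightarrow> nat \<Rightarrow> (nat \<Rightarrow> 'a sgraph) \<Rightarrow> (nat set \<Rightarrow> nat) \<Rightarrow> nat" where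
  "nim n k H \<phi> = card {e. nim_edge n k H \<phi> e}"

definition feasible :: "nat \<Rightarrow> nat \<Rightarrow> (nat \<Rightarrow> 'a sgraph) \<Rightarrow> (nat set \<Rightarrow> nat) \<Rightarrow> bool" where
  "feasible r k H \<xi> \<longleftrightarrow>
     \<xi> \<in> {A. A \<subseteq> {1..r} \<and> card A \<le> 2} \<rightarrow> {1..k} \<and>
     (\<forall>i\<in>{1..k}. \<not> (\<exists>f. graph_hom f (H i) ({1..r}, {e \<in> nsets {1..r} 2. \<xi> e = i}))) \<and>
     (\<forall>a\<in>{1..r}. \<forall>b\<in>{1..r}. a \<noteq> b \<longrightarrow> \<xi> {a, b} \<noteq> \<xi> {a})"

text \<open>By Ramsey's theorem the feasible orders are bounded when \<open>k \<ge> 1\<close> and every \<open>H i\<close> is a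
  finite simple graph.  If moreover every \<open>H i\<close> has an edge (in particular if it is not
  bipartite), then \<open>r = 1\<close> admits a feasible colouring, so the maximum exists and is positive.\<close>
definition r_star :: "nat \<Rightarrow> (nat \<Rightarrow> 'a sgraph) \<Rightarrow> nat" where
  "r_star k H = (GREATEST r. \<exists>\<xi>. feasible r k H \<xi>)"

text \<open>Meaningful for finite graphs of the same order, where the set of values is finite and
  nonempty.\<close>
definition edit_distance :: "'a sgraph \<Rightarrow> 'b sgraph \<Rightarrow> nat" where
  "edit_distance G H =
     Min {card (sym_diff (edges G) ((\<lambda>e. \<sigma> ` e) ` edges H)) | \<sigma>. bij_betw \<sigma> (verts H) (verts G)}"

end

theory Submission
  imports Defs
begin

text \<open>
  Write \<open>r\<close> for \<open>r_star\<close>.  If the NIM-graph contained a complete \<open>(r + 1)\<close>-partite graph with large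
  parts, Ramsey's theorem would give subparts such that all parts and all pairs of parts are
  monochromatic; their colours form a feasible colouring on \<open>r + 1\<close> points, which is impossible.
  Hence, by Erdos's theorem on complete multipartite hypergraphs, the NIM-graph has only
  \<open>o(n^(r+1))\<close> cliques of size \<open>r + 1\<close>.  A version of Fueredi's proof of the stability theorem that
  tolerates few cliques then yields a partition into \<open>r\<close> classes with few edges inside the
  classes.  By the edge count the classes are almost balanced and almost all pairs between them
  are edges.
\<close>

text \<open>A single \<open>(r + 1)\<close>-clique of NIM-edges contradicts nothing: (P2) compares
  the colour of a pair with that of a point, and a vertex of the coloured graph has no colour. A
  point acquires one only as a large part whose internal pairs share a colour. Large parts also give
  the room to place the vertices of \<open>H i\<close> injectively when a homomorphism in (P1)
  identifies some of them. Hence cliques cannot be forbidden, only shown to be few, and the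
  stability argument has to absorb that.

  One inequality then does the work. Counting ordered pairs, let \<open>E\<close> be the number of
  edges, \<open>In\<close> the number of those inside classes and \<open>P\<close> the number of
  pairs between classes; the partition satisfies \<open>E + In \<le> P + \<beta> n^2\<close>. Since
  \<open>P\<close> is at most the Turan value \<open>q = (1 - 1/r) n^2\<close>, with defect exactly
  the sum of squared deviations of the class sizes from \<open>n/r\<close>, a lower bound on
  \<open>E\<close> controls \<open>In\<close>, the missing pairs and the imbalance
  simultaneously.\<close>

section \<open>Ordered cliques and boxes in dense relations\<close>

text \<open>Cliques are lists, so a clique of a symmetric irreflexive relation is counted once per
  ordering. In return the count splits exactly over the first vertex, and a complete multipartite
  subgraph is a \<open>listset\<close> contained in this set.\<close>

definition cliques :: "('v \<Rightarrow> 'v \<Rightarrow> bool) \<Rightarrow> 'v set \<Rightarrow> nat \<Rightarrow> 'v list set" where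
  "cliques adj V m = {xs. set xs \<subseteq> V \<and> length xs = m \<and> sorted_wrt adj xs}"

lemma card_lists_Cons:
  assumes "finite V" and "R \<subseteq> {xs. set xs \<subseteq> V \<and> length xs = Suc m}"
  shows "card R = (\<Sum>x\<in>V. card {t. x # t \<in> R})"
proof -
  have finR: "finite R"
    by (rule finite_subset[OF assms(2) finite_lists_length_eq[OF assms(1)]])
  have R: "R = (\<Union>x\<in>V. (#) x ` {t. x # t \<in> R})"
  proof (intro subset_antisym subsetI)
    fix xs assume xs: "xs \<in> R"
    then obtain y ys where "xs = y # ys" "y \<in> V"
      using assms(2) by (cases xs) auto
    then show "xs \<in> (\<Union>x\<in>V. (#) x ` {t. x # t \<in> R})"
      using xs by auto
  qed auto
  have fin: "finite ((#) x ` {t. x # t \<in> R})" for x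
    by (rule finite_subset[OF _ finR]) auto
  have "card R = (\<Sum>x\<in>V. card ((#) x ` {t. x # t \<in> R}))"
    by (subst R, rule card_UN_disjoint) (use assms fin in auto)
  also have "\<dots> = (\<Sum>x\<in>V. card {t. x # t \<in> R})"
    by (intro sum.cong refl card_image) auto
  finally show ?thesis .
qed

lemma card_cliques_Suc:
  assumes "finite V"
  shows "card (cliques adj V (Suc m)) = (\<Sum>x\<in>V. card (cliques adj {y \<in> V. adj x y} m))"
proof -
  have "card (cliques adj V (Suc m)) = (\<Sum>x\<in>V. card {t. x # t \<in> cliques adj V (Suc m)})"
    by (rule card_lists_Cons[OF assms]) (auto simp: cliques_def)
  also have "\<dots> = (\<Sum>x\<in>V. card (cliques adj {y \<in> V. adj x y} m))"
    by (intro sum.cong refl arg_cong[where f = card]) (auto simp: cliques_def)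
  finally show ?thesis .
qed

text \<open>Erdos's theorem, by induction on the length. Keep only a bounded number \<open>L\<close>
  of first entries that have many continuations. On average a tail is compatible with a positive
  proportion of them, so many tails have at least \<open>M\<close> compatible first entries; as
  these entries lie in a set of size \<open>L\<close>, a single choice of \<open>M\<close> of them
  serves a positive fraction of the tails.\<close>

lemma box_in_dense_relation:
  fixes c :: real
  assumes "c > 0"
  shows "\<exists>n0. \<forall>n\<ge>n0. \<forall>(V :: 'v set) R. finite V \<longrightarrow> card V \<le> n \<longrightarrow>
    R \<subseteq> {xs. set xs \<subseteq> V \<and> length xs = m} \<longrightarrow> c * real n ^ m \<le> real (card R) \<longrightarrow>
    (\<exists>As. length As = m \<and> (\<forall>A\<in>set As. A \<subseteq> V \<and> card A = M) \<and> listset As \<subseteq> R)"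
  using assms
proof (induction m arbitrary: c)
  case 0
  show ?case
  proof (intro exI[of _ 0] allI impI)
    fix n and V :: "'v set" and R :: "'v list set"
    assume R: "R \<subseteq> {xs. set xs \<subseteq> V \<and> length xs = 0}" and "c * real n ^ 0 \<le> real (card R)"
    then have "R \<noteq> {}"
      using 0 by auto
    then have "[] \<in> R"
      using R by auto
    then show "\<exists>As. length As = 0 \<and> (\<forall>A\<in>set As. A \<subseteq> V \<and> card A = M) \<and> listset As \<subseteq> R"
      by (intro exI[of _ "[]"]) auto
  qed
next
  case (Suc m)
  \<comment> \<open>Tails compatible with fewer than \<open>M\<close> of the \<open>L\<close>
    entries contribute at most \<open>M\<close> each, which may use up half of the guaranteed total
    \<open>L * (c / 2 * n ^ m)\<close>; hence the 4. The \<open>+ 1\<close> keeps \<open>L\<close>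
    positive even when \<open>M = 0\<close>.\<close>
  define L where "L = nat \<lceil>4 * (real M + 1) / c\<rceil>"
  have "real L \<ge> 4 * (real M + 1) / c"
    unfolding L_def by linarith
  then have L: "real L * c / 4 \<ge> real M + 1"
    using \<open>c > 0\<close> by (simp add: field_simps)
  then have Lpos: "L > 0"
    by (cases "L = 0") auto
  \<comment> \<open>At least \<open>c / 4 * n ^ m\<close> tails survive, and one of the
    \<open>2 ^ L\<close> subsets of \<open>S\<close> is assigned to a fraction
    \<open>1 / 2 ^ L\<close> of them.\<close>
  define c' where "c' = c / 4 / 2 ^ L"
  have "c' > 0"
    unfolding c'_def using \<open>c > 0\<close> by simp
  then obtain n1 where n1: "\<forall>n\<ge>n1. \<forall>(V :: 'v set) R. finite V \<longrightarrow> card V \<le> n \<longrightarrow>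
    R \<subseteq> {xs. set xs \<subseteq> V \<and> length xs = m} \<longrightarrow> c' * real n ^ m \<le> real (card R) \<longrightarrow>
    (\<exists>As. length As = m \<and> (\<forall>A\<in>set As. A \<subseteq> V \<and> card A = M) \<and> listset As \<subseteq> R)"
    using Suc.IH[of c'] by (elim meta_impE exE) (assumption, rule that)
  \<comment> \<open>The second bound forces at least \<open>L\<close> first entries with many
    continuations; its \<open>+ 1\<close> makes \<open>n\<close> positive for the
    cancellations.\<close>
  define n0 where "n0 = max n1 (nat \<lceil>2 * real L / c\<rceil> + 1)"
  show ?case
  proof (intro exI[of _ n0] allI impI)
    fix n and V :: "'v set" and R :: "'v list set"
    assume n: "n0 \<le> n" and V: "finite V" "card V \<le> n"
      and R: "R \<subseteq> {xs. set xs \<subseteq> V \<and> length xs = Suc m}"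
      and cR: "c * real n ^ Suc m \<le> real (card R)"
    have npos: "real n > 0"
      using n unfolding n0_def by auto
    have "real n \<ge> 2 * real L / c"
      using n unfolding n0_def by linarith
    then have nL: "real n * c / 2 \<ge> real L"
      using \<open>c > 0\<close> by (simp add: field_simps)
    define T where "T = {t. set t \<subseteq> V \<and> length t = m}"
    have finT: "finite T"
      unfolding T_def by (rule finite_lists_length_eq[OF V(1)])
    have "card T = card V ^ m"
      unfolding T_def by (rule card_lists_length_eq[OF V(1)])
    then have cT: "real (card T) \<le> real n ^ m"
      using V(2) by (simp add: power_mono)
    have RT: "{t. x # t \<in> R} \<subseteq> T" for x
      using subsetD[OF R, of "x # _"] by (fastforce simp: T_def)
    have RT': "real (card {t. x # t \<in> R}) \<le> real n ^ m" for x
      using card_mono[OF finT RT[of x]] cT by linarith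
    define good where "good = {x \<in> V. c / 2 * real n ^ m \<le> real (card {t. x # t \<in> R})}"
    have "real (card R) = (\<Sum>x\<in>V. real (card {t. x # t \<in> R}))"
      using card_lists_Cons[OF V(1) R] by simp
    also have "\<dots> \<le> (\<Sum>x\<in>V. (if x \<in> good then real n ^ m else 0) + c / 2 * real n ^ m)"
      by (rule sum_mono) (use RT' \<open>c > 0\<close> in \<open>auto simp: good_def intro: add_increasing2\<close>)
    also have "\<dots> = real (card good) * real n ^ m + real (card V) * (c / 2 * real n ^ m)"
    proof -
      have "V \<inter> good = good" by (auto simp: good_def)
      then show ?thesis using V(1) by (simp add: sum.distrib sum.If_cases)
    qed
    also have "\<dots> \<le> real (card good) * real n ^ m + real n * (c / 2 * real n ^ m)"
      using V(2) \<open>c > 0\<close> by (intro add_left_mono mult_right_mono) auto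
    finally have "(c * real n) * real n ^ m \<le> (real (card good) + real n * c / 2) * real n ^ m"
      using cR by (simp add: algebra_simps)
    then have "c * real n \<le> real (card good) + real n * c / 2"
      using npos by (simp add: mult_le_cancel_right)
    then have "real L \<le> real (card good)"
      using nL by (simp add: mult.commute[of c])
    then have "L \<le> card good"
      by simp
    then obtain S where S: "S \<subseteq> good" "card S = L" "finite S"
      using obtain_subset_with_card_n by blast
    define d where "d t = card {x \<in> S. x # t \<in> R}" for t
    define T' where "T' = {t \<in> T. M \<le> d t}"
    have dL: "d t \<le> L" for t
      unfolding d_def S(2)[symmetric] by (intro card_mono S(3)) auto
    have "real L * (c / 2 * real n ^ m) \<le> (\<Sum>x\<in>S. real (card {t. x # t \<in> R}))"
      using sum_mono[of S "\<lambda>_. c / 2 * real n ^ m" "\<lambda>x. real (card {t. x # t \<in> R})"] S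
      by (auto simp: good_def)
    also have "\<dots> = (\<Sum>x\<in>S. \<Sum>t\<in>T. if x # t \<in> R then 1 else 0)"
    proof (intro sum.cong refl)
      fix x
      have "{t. x # t \<in> R} = {t \<in> T. x # t \<in> R}"
        using RT by auto
      then show "real (card {t. x # t \<in> R}) = (\<Sum>t\<in>T. if x # t \<in> R then 1 else 0)"
        using finT by (simp add: sum.If_cases Int_def)
    qed
    also have "\<dots> = (\<Sum>t\<in>T. \<Sum>x\<in>S. if x # t \<in> R then 1 else 0)"
      by (rule sum.swap)
    also have "\<dots> = (\<Sum>t\<in>T. real (d t))"
      using S(3) by (simp add: sum.If_cases Int_def d_def)
    also have "\<dots> \<le> (\<Sum>t\<in>T. (if t \<in> T' then real L else 0) + real M)"
      by (rule sum_mono) (use dL in \<open>auto simp: T'_def intro: add_increasing2\<close>)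
    also have "\<dots> = real (card T') * real L + real (card T) * real M"
    proof -
      have "T \<inter> T' = T'" by (auto simp: T'_def)
      then show ?thesis using finT by (simp add: sum.distrib sum.If_cases)
    qed
    also have "\<dots> \<le> real (card T') * real L + real n ^ m * (real L * c / 4)"
      using cT L npos by (intro add_left_mono mult_mono) auto
    finally have "real L * (c / 4 * real n ^ m) \<le> real L * real (card T')"
      by (simp add: algebra_simps)
    then have cT': "c / 4 * real n ^ m \<le> real (card T')"
      using Lpos by simp
    have finT': "finite T'"
      unfolding T'_def using finT by simp
    have "\<exists>A. A \<subseteq> {x \<in> S. x # t \<in> R} \<and> card A = M" if "t \<in> T'" for t
      using that obtain_subset_with_card_n[of M "{x \<in> S. x # t \<in> R}"] unfolding T'_def d_def by blast
    then obtain A where A: "\<And>t. t \<in> T' \<Longrightarrow> A t \<subseteq> {x \<in> S. x # t \<in> R} \<and> card (A t) = M"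
      by metis
    have "A \<in> T' \<rightarrow> Pow S"
      using A by blast
    from pigeonhole_card[OF this finT'] S(3) obtain A0
      where A0: "A0 \<in> Pow S" "card T' \<le> card (A -` {A0} \<inter> T') * card (Pow S)"
      by auto
    define R' where "R' = A -` {A0} \<inter> T'"
    have "card T' \<le> card R' * 2 ^ L"
      using A0(2) S unfolding R'_def by (simp add: card_Pow)
    then have "real (card T') \<le> real (card R' * 2 ^ L)"
      by (simp only: of_nat_le_iff)
    then have "real (card T') \<le> real (card R') * 2 ^ L"
      by simp
    then have c'R: "c' * real n ^ m \<le> real (card R')"
      using cT' unfolding c'_def by (simp add: field_simps)
    \<comment> \<open>Pigeonhole yields some subset of \<open>S\<close> of unknown size. That its
      fibre is nonempty shows that it is a value of \<open>A\<close>, hence of size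
      \<open>M\<close>.\<close>
    have "c' * real n ^ m > 0"
      using \<open>c' > 0\<close> npos by simp
    then have "R' \<noteq> {}"
      using c'R by auto
    then have cA0: "card A0 = M"
      using A unfolding R'_def by auto
    have "R' \<subseteq> {xs. set xs \<subseteq> V \<and> length xs = m}"
      unfolding R'_def T'_def T_def by auto
    moreover have "n \<ge> n1"
      using n unfolding n0_def by simp
    ultimately obtain As where As: "length As = m" "\<forall>A\<in>set As. A \<subseteq> V \<and> card A = M" "listset As \<subseteq> R'"
      using n1[rule_format, OF _ V _ c'R] by auto
    have "A0 \<subseteq> V"
      using A0(1) S(1) unfolding good_def by auto
    moreover have "listset (A0 # As) \<subseteq> R"
      using As(3) A unfolding R'_def by (fastforce simp: set_Cons_def)
    ultimately show "\<exists>As. length As = Suc m \<and> (\<forall>A\<in>set As. A \<subseteq> V \<and> card A = M) \<and> listset As \<subseteq> R"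
      using As(1,2) cA0 by (intro exI[of _ "A0 # As"]) auto
  qed
qed

section \<open>Ordered pairs and stability for graphs with few cliques\<close>

text \<open>With ordered pairs an edge of a symmetric loopless graph counts twice, which clears the
  factor 1/2 from the edge bounds and turns counts into degree sums.\<close>

definition pairs :: "'v set \<Rightarrow> 'v set \<Rightarrow> ('v \<Rightarrow> 'v \<Rightarrow> bool) \<Rightarrow> ('v \<times> 'v) set" where
  "pairs A B P = {(x, y). x \<in> A \<and> y \<in> B \<and> P x y}"

lemma finite_pairs: "finite A \<Longrightarrow> finite B \<Longrightarrow> finite (pairs A B P)"
  by (rule finite_subset[of _ "A \<times> B"]) (auto simp: pairs_def)

lemma card_pairs:
  assumes "finite A" "finite B"
  shows "card (pairs A B P) = (\<Sum>x\<in>A. card {y \<in> B. P x y})"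
proof -
  have "pairs A B P = (SIGMA x:A. {y \<in> B. P x y})"
    by (auto simp: pairs_def)
  then show ?thesis
    using assms by simp
qed

lemma card_pairs_swap: "card (pairs A B P) = card (pairs B A (\<lambda>x y. P y x))"
  by (rule bij_betw_same_card[of prod.swap]) (auto simp: pairs_def bij_betw_def inj_on_def image_iff)

lemma card_pairs_Un_left:
  assumes "finite A" "finite A'" "finite B" "A \<inter> A' = {}"
  shows "card (pairs (A \<union> A') B P) = card (pairs A B P) + card (pairs A' B P)"
  using assms by (simp add: card_pairs sum.union_disjoint)

lemma card_pairs_Un_right:
  assumes "finite A" "finite B" "finite B'" "B \<inter> B' = {}"
  shows "card (pairs A (B \<union> B') P) = card (pairs A B P) + card (pairs A B' P)"
  using card_pairs_Un_left[of B B' A "\<lambda>x y. P y x"] assms by (simp add: card_pairs_swap[of A])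

lemma pairs_cong:
  "(\<And>x y. x \<in> A \<Longrightarrow> y \<in> B \<Longrightarrow> P x y = Q x y) \<Longrightarrow> pairs A B P = pairs A B Q"
  by (auto simp: pairs_def)

lemma card_pairs_split:
  assumes "finite N" "finite U" "N \<inter> U = {}"
  shows "card (pairs (N \<union> U) (N \<union> U) P) =
    card (pairs N N P) + card (pairs N U P) + card (pairs U N P) + card (pairs U U P)"
  using assms by (simp add: card_pairs_Un_left card_pairs_Un_right)

lemma card_pairs_True: "card (pairs A B (\<lambda>_ _. True)) = card A * card B"
proof -
  have "pairs A B (\<lambda>_ _. True) = A \<times> B"
    by (auto simp: pairs_def)
  then show ?thesis
    by (simp add: card_cartesian_product)
qed

lemma pairs_False: "pairs A B (\<lambda>_ _. False) = {}"
  by (simp add: pairs_def)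

text \<open>Fueredi's argument: split off the non-neighbours of a vertex of maximum degree among those
  whose neighbourhood contains few cliques, and recurse into the neighbourhood.\<close>
lemma partition_if_few_cliques:
  fixes \<beta> :: real
  assumes "\<beta> > 0"
  shows "\<exists>\<eta>>0. \<forall>n (V :: 'v set) adj. symp adj \<longrightarrow> finite V \<longrightarrow> card V \<le> n \<longrightarrow>
    real (card (cliques adj V (r + 2))) \<le> \<eta> * real n ^ (r + 2) \<longrightarrow>
    (\<exists>f. f ` V \<subseteq> {..r} \<and>
      real (card (pairs V V adj)) + real (card (pairs V V (\<lambda>x y. adj x y \<and> f x = f y)))
        \<le> real (card (pairs V V (\<lambda>x y. f x \<noteq> f y))) + \<beta> * (real n)\<^sup>2)"
  using assms
proof (induction r arbitrary: \<beta>)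
  case 0
  show ?case
  \<comment> \<open>Cliques of length 2 are exactly the ordered adjacent pairs. With one class both
    terms on the left equal their number and no pair is separated, hence half of \<beta>.\<close>
  proof (intro exI[of _ "\<beta> / 2"] conjI allI impI)
    show "\<beta> / 2 > 0" using 0 by simp
    fix n and V :: "'v set" and adj
    assume V: "finite V" and c: "real (card (cliques adj V (0 + 2))) \<le> \<beta> / 2 * real n ^ (0 + 2)"
    have "card (cliques adj V (0 + 2)) = card (pairs V V adj)"
    proof -
      have 1: "cliques adj X 0 = {[]}" for X
        by (auto simp: cliques_def)
      have 2: "card (cliques adj X (Suc 0)) = card X" if "finite X" for X
        using card_cliques_Suc[OF that, of adj 0] by (simp add: 1)
      show ?thesis
        using card_cliques_Suc[OF V, of adj "Suc 0"] V by (simp add: 2 card_pairs numeral_2_eq_2)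
    qed
    then show "\<exists>f. f ` V \<subseteq> {..0::nat} \<and>
      real (card (pairs V V adj)) + real (card (pairs V V (\<lambda>x y. adj x y \<and> f x = f y)))
        \<le> real (card (pairs V V (\<lambda>x y. f x \<noteq> f y))) + \<beta> * (real n)\<^sup>2"
      using c by (intro exI[of _ "\<lambda>_. 0"]) (auto simp: power2_eq_square)
  qed
next
  case (Suc r)
  then have "\<beta> / 2 > 0" by simp
  then obtain \<eta>' where "\<eta>' > 0" and \<eta>': "\<forall>n (V :: 'v set) adj. symp adj \<longrightarrow> finite V \<longrightarrow> card V \<le> n \<longrightarrow>
    real (card (cliques adj V (r + 2))) \<le> \<eta>' * real n ^ (r + 2) \<longrightarrow>
    (\<exists>f. f ` V \<subseteq> {..r} \<and>
      real (card (pairs V V adj)) + real (card (pairs V V (\<lambda>x y. adj x y \<and> f x = f y)))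
        \<le> real (card (pairs V V (\<lambda>x y. f x \<noteq> f y))) + \<beta> / 2 * (real n)\<^sup>2)"
    using Suc.IH[of "\<beta> / 2"] by (elim meta_impE exE conjE) (assumption, rule that)
  \<comment> \<open>The exceptional vertices will cost \<open>2 * \<alpha> * n^2\<close>, which has
    to fit into the \<open>\<beta> / 2\<close> not spent by the induction hypothesis.\<close>
  define \<alpha> where "\<alpha> = min (\<beta> / 4) 1"
  have \<alpha>: "\<alpha> > 0" "\<alpha> \<le> 1" "4 * \<alpha> \<le> \<beta>"
    unfolding \<alpha>_def using \<open>\<beta> > 0\<close> by auto
  show ?case
  proof (intro exI[of _ "\<eta>' * \<alpha>"] conjI allI impI)
    show "\<eta>' * \<alpha> > 0" using \<open>\<eta>' > 0\<close> \<alpha> by simp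
    fix n and V :: "'v set" and adj
    assume sym: "symp adj" and V: "finite V" "card V \<le> n"
      and c: "real (card (cliques adj V (Suc r + 2))) \<le> \<eta>' * \<alpha> * real n ^ (Suc r + 2)"
    define nb where "nb x = {y \<in> V. adj x y}" for x
    have fin_nb: "finite (nb x)" for x
      unfolding nb_def using V by simp
    have nb_n: "card (nb x) \<le> n" for x
      using card_mono[of V "nb x"] V unfolding nb_def by auto
    \<comment> \<open>Markov: each such vertex starts more than \<open>\<eta>' * n ^ (r + 2)\<close>
      of the cliques, so a total of at most \<open>\<eta>' * \<alpha> * n ^ (r + 3)\<close> allows
      at most \<open>\<alpha> * n\<close> of them.\<close>
    define bad where "bad = {x \<in> V. real (card (cliques adj (nb x) (r + 2))) > \<eta>' * real n ^ (r + 2)}"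
    have bad_fin: "finite bad"
      unfolding bad_def using V by simp
    have bad_n: "real (card bad) \<le> \<alpha> * real n"
    proof (cases "n = 0")
      case True
      then show ?thesis using V unfolding bad_def by simp
    next
      case False
      have "real (card bad) * (\<eta>' * real n ^ (r + 2))
        = (\<Sum>x\<in>bad. \<eta>' * real n ^ (r + 2))" by simp
      also have "\<dots> \<le> (\<Sum>x\<in>bad. real (card (cliques adj (nb x) (r + 2))))"
        by (rule sum_mono) (simp add: bad_def)
      also have "\<dots> \<le> (\<Sum>x\<in>V. real (card (cliques adj (nb x) (r + 2))))"
        by (rule sum_mono2) (use V in \<open>auto simp: bad_def\<close>)
      also have "\<dots> = real (card (cliques adj V (Suc r + 2)))"
        using card_cliques_Suc[OF V(1), of adj "r + 2"] by (simp add: nb_def)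
      also have "\<dots> \<le> (\<alpha> * real n) * (\<eta>' * real n ^ (r + 2))"
        using c by (simp add: algebra_simps)
      finally show ?thesis
        using False \<open>\<eta>' > 0\<close> by (simp add: mult_le_cancel_right)
    qed
    show "\<exists>f. f ` V \<subseteq> {..Suc r} \<and>
      real (card (pairs V V adj)) + real (card (pairs V V (\<lambda>x y. adj x y \<and> f x = f y)))
        \<le> real (card (pairs V V (\<lambda>x y. f x \<noteq> f y))) + \<beta> * (real n)\<^sup>2"
    proof (cases "bad = V")
      case True
      \<comment> \<open>There is no vertex to split off, but \<open>V\<close> itself then has at
        most \<open>\<alpha> * n\<close> elements, and the error term pays for all pairs.\<close>
      have "card (pairs V V adj) \<le> card (V \<times> V)"
        by (rule card_mono) (use V in \<open>auto simp: pairs_def\<close>)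
      then have "real (card (pairs V V adj)) \<le> real (card V) * real (card V)"
        by (simp add: card_cartesian_product flip: of_nat_mult)
      also have "\<dots> \<le> (\<alpha> * real n) * real n"
        using bad_n True V(2) \<alpha> by (intro mult_mono) auto
      finally have "2 * real (card (pairs V V adj)) \<le> \<beta> * (real n)\<^sup>2"
        using \<alpha> mult_right_mono[of "2 * \<alpha>" \<beta> "(real n)\<^sup>2"] by (simp add: power2_eq_square)
      then show ?thesis
        by (intro exI[of _ "\<lambda>_. 0"]) auto
    next
      case False
      then have ne: "V - bad \<noteq> {}" and fin: "finite (V - bad)"
        using V unfolding bad_def by auto
      have "\<exists>x0\<in>V - bad. \<forall>x\<in>V - bad. card (nb x) \<le> card (nb x0)"
        using Max_in[of "(\<lambda>x. card (nb x)) ` (V - bad)"] Max_ge[of "(\<lambda>x. card (nb x)) ` (V - bad)"] ne fin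
        by fastforce
      then obtain x0 where x0: "x0 \<in> V - bad" and max: "\<And>x. x \<in> V - bad \<Longrightarrow> card (nb x) \<le> card (nb x0)"
        by blast
      define N U where "N = nb x0" and "U = V - nb x0"
      have NU: "V = N \<union> U" "N \<inter> U = {}" "finite N" "finite U"
        unfolding N_def U_def using V fin_nb by (auto simp: nb_def)
      have "real (card (cliques adj N (r + 2))) \<le> \<eta>' * real n ^ (r + 2)"
        using x0 unfolding bad_def N_def by auto
      then obtain g where g: "g ` N \<subseteq> {..r}" and gN:
        "real (card (pairs N N adj)) + real (card (pairs N N (\<lambda>x y. adj x y \<and> g x = g y)))
          \<le> real (card (pairs N N (\<lambda>x y. g x \<noteq> g y))) + \<beta> / 2 * (real n)\<^sup>2"
        using \<eta>'[rule_format, OF sym NU(3)] nb_n[of x0] unfolding N_def by blast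
      \<comment> \<open>\<open>U\<close> becomes a class with the label \<open>Suc r\<close>, which
        \<open>g\<close> never uses on \<open>N\<close>. Edges inside \<open>U\<close> are not
        excluded; they are charged to the degrees in \<open>U\<close>.\<close>
      define f where "f x = (if x \<in> N then g x else Suc r)" for x
      have fN: "f x = g x" if "x \<in> N" for x
        using that by (simp add: f_def)
      have fU: "f x = Suc r" if "x \<in> U" for x
        using that NU by (auto simp: f_def)
      have gr: "g x \<noteq> Suc r" if "x \<in> N" for x
        using that g by force
      have fV: "f ` V \<subseteq> {..Suc r}"
        using g unfolding f_def by (auto simp: le_SucI image_subset_iff)
      have "card (pairs V V (\<lambda>x y. f x \<noteq> f y)) = card (pairs N N (\<lambda>x y. g x \<noteq> g y))
        + card (pairs N U (\<lambda>_ _. True)) + card (pairs U N (\<lambda>_ _. True)) + card (pairs U U (\<lambda>_ _. False))"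
        unfolding NU(1) card_pairs_split[OF NU(3,4,2)]
        using gr by (intro arg_cong2[where f = "(+)"] arg_cong[where f = card] pairs_cong)
           (auto simp: fN fU gr gr[symmetric])
      then have P: "card (pairs V V (\<lambda>x y. f x \<noteq> f y))
        = card (pairs N N (\<lambda>x y. g x \<noteq> g y)) + 2 * (card U * card N)"
        by (simp add: card_pairs_True pairs_False)
      have "card (pairs V V (\<lambda>x y. adj x y \<and> f x = f y)) = card (pairs N N (\<lambda>x y. adj x y \<and> g x = g y))
        + card (pairs N U (\<lambda>_ _. False)) + card (pairs U N (\<lambda>_ _. False)) + card (pairs U U adj)"
        unfolding NU(1) card_pairs_split[OF NU(3,4,2)]
        by (intro arg_cong2[where f = "(+)"] arg_cong[where f = card] pairs_cong)
           (auto simp: fN fU gr gr[symmetric])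
      then have In: "card (pairs V V (\<lambda>x y. adj x y \<and> f x = f y))
        = card (pairs N N (\<lambda>x y. adj x y \<and> g x = g y)) + card (pairs U U adj)"
        by (simp add: pairs_False)
      have "(\<lambda>x y. adj y x) = adj"
        using sym by (auto simp: symp_def fun_eq_iff)
      then have NUsym: "card (pairs N U adj) = card (pairs U N adj)"
        using card_pairs_swap[of N U adj] by simp
      have E: "card (pairs V V adj) = card (pairs N N adj) + 2 * card (pairs U N adj) + card (pairs U U adj)"
        unfolding NU(1) card_pairs_split[OF NU(3,4,2)] by (simp add: NUsym)
      have D: "card (pairs U V adj) = card (pairs U N adj) + card (pairs U U adj)"
        unfolding NU(1) using NU by (simp add: card_pairs_Un_right)
      \<comment> \<open>By \<open>E\<close>, \<open>In\<close> and \<open>D\<close>, the left side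
        of the goal contains the degree sum over \<open>U\<close> twice, while by \<open>P\<close>
        the right side gains \<open>2 * (card U * card N)\<close>. So the degrees in
        \<open>U\<close> should be at most \<open>card N\<close>: maximality gives this outside
        \<open>bad\<close>, and bad vertices get the trivial bound \<open>n\<close>.\<close>
      have "real (card (pairs U V adj)) = (\<Sum>x\<in>U. real (card (nb x)))"
        using card_pairs[OF NU(4) V(1), of adj] by (simp add: nb_def)
      also have "\<dots> \<le> (\<Sum>x\<in>U. real (card N) + (if x \<in> bad then real n else 0))"
      proof (rule sum_mono)
        fix x assume "x \<in> U"
        then show "real (card (nb x)) \<le> real (card N) + (if x \<in> bad then real n else 0)"
          using max[of x] nb_n[of x] NU by (cases "x \<in> bad") (auto simp: N_def intro: add_increasing)
      qed
      also have "\<dots> = real (card U) * real (card N) + real (card (U \<inter> bad)) * real n"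
        using NU(4) by (simp add: sum.distrib sum.If_cases)
      also have "\<dots> \<le> real (card U) * real (card N) + (\<alpha> * real n) * real n"
        using bad_n card_mono[OF bad_fin, of "U \<inter> bad"] by (intro add_left_mono mult_right_mono) auto
      finally have "real (card (pairs U V adj)) \<le> real (card U) * real (card N) + \<alpha> * (real n)\<^sup>2"
        by (simp add: power2_eq_square)
      moreover have "2 * (\<alpha> * (real n)\<^sup>2) \<le> \<beta> / 2 * (real n)\<^sup>2"
        using \<alpha> mult_right_mono[of "2 * \<alpha>" "\<beta> / 2" "(real n)\<^sup>2"] by simp
      ultimately show ?thesis
        using gN fV by (intro exI[of _ f]) (auto simp: P In E D)
    qed
  qed
qed

section \<open>Ramsey's theorem and feasible colourings from NIM-edges\<close>

text \<open>The colour is read from the increasing pair, so \<open>f\<close> need not be symmetric,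
  and for this reason an increasing enumeration \<open>e\<close> is returned instead of a set. The
  colour set is arbitrary, which allows whole tables of colours as values.\<close>

lemma ramsey_pairs:
  fixes C :: "'c set" and q :: nat
  assumes "finite C"
  shows "\<exists>N :: nat. \<forall>f :: nat \<Rightarrow> nat \<Rightarrow> 'c. (\<forall>i j. i < j \<longrightarrow> j < N \<longrightarrow> f i j \<in> C) \<longrightarrow>
    (\<exists>(e :: nat \<Rightarrow> nat) c. (\<forall>t<q. e t < N) \<and> (\<forall>s t. s < t \<longrightarrow> t < q \<longrightarrow> e s < e t \<and> f (e s) (e t) = c))"
proof -
  obtain g where g: "bij_betw g C {0..<card C}"
    using ex_bij_betw_finite_nat[OF assms] by blast
  obtain N :: nat where N: "partn_lst {..<N} (replicate (card C) q) 2"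
    using ramsey_full by blast
  show ?thesis
  proof (intro exI[of _ N] allI impI)
    fix f :: "nat \<Rightarrow> nat \<Rightarrow> 'c"
    assume f: "\<forall>i j. i < j \<longrightarrow> j < N \<longrightarrow> f i j \<in> C"
    define F where "F X = g (f (Min X) (Max X))" for X
    have F: "F {i, j} = g (f i j)" if "i < j" for i j
      using that unfolding F_def by (simp add: min_def max_def)
    have "F \<in> nsets {..<N} 2 \<rightarrow> {..<length (replicate (card C) q)}"
    proof
      fix X assume "X \<in> nsets {..<N} 2"
      then obtain i j where ij: "X = {i, j}" "i < j" "j < N"
        by (auto simp: ordered_nsets_2_eq)
      then show "F X \<in> {..<length (replicate (card C) q)}"
        using F[OF ij(2)] f g by (auto simp: bij_betw_def)
    qed
    then obtain i I where i: "i < card C" and I: "I \<in> nsets {..<N} q" and FI: "F ` nsets I 2 \<subseteq> {i}"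
      using N unfolding partn_lst_def monochromatic_def by fastforce
    have Ip: "finite I" "card I = q" "I \<subseteq> {..<N}"
      using I by (auto simp: nsets_def)
    define e where "e t = sorted_list_of_set I ! t" for t
    have e_in: "e t \<in> I" if "t < q" for t
      using that Ip nth_mem[of t "sorted_list_of_set I"] unfolding e_def by simp
    have e_less: "e s < e t" if "s < t" "t < q" for s t
      using that Ip strict_sorted_list_of_set[of I] unfolding e_def by (simp add: sorted_wrt_iff_nth_less)
    have "f (e s) (e t) = inv_into C g i" if st: "s < t" "t < q" for s t
    proof -
      have "{e s, e t} \<in> nsets I 2"
        using st e_in e_less[OF st] by simp
      then have "g (f (e s) (e t)) = i"
        using FI F[OF e_less[OF st]] by (simp add: image_subset_iff)
      moreover have "f (e s) (e t) \<in> C"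
        using f[rule_format, OF e_less[OF st]] e_in[OF st(2)] Ip(3) by blast
      ultimately show ?thesis
        using bij_betw_inv_into_left[OF g, of "f (e s) (e t)"] by simp
    qed
    moreover have "e t < N" if "t < q" for t
      using e_in[OF that] Ip(3) by blast
    ultimately show "\<exists>e c. (\<forall>t<q. e t < N) \<and> (\<forall>s t. s < t \<longrightarrow> t < q \<longrightarrow> e s < e t \<and> f (e s) (e t) = c)"
      using e_less by (intro exI[of _ e] exI[of _ "inv_into C g i"]) simp
  qed
qed

lemma not_nim_edge_if_monochromatic_copy:
  assumes "finite_simple_graph (H i)" "i \<in> {1..k}"
    and inj: "inj_on h (verts (H i))" and ran: "h ` verts (H i) \<subseteq> {1..n}"
    and mono: "\<And>e. e \<in> edges (H i) \<Longrightarrow> \<phi> (h ` e) = i"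
    and "e \<in> edges (H i)"
  shows "\<not> nim_edge n k H \<phi> (h ` e)"
proof -
  define F where "F = (h ` verts (H i), (\<lambda>e. h ` e) ` edges (H i))"
  have "graph_iso h (H i) F"
    unfolding graph_iso_def F_def using inj by (simp add: bij_betw_def)
  moreover have "edges F \<subseteq> edges (complete_graph n)"
  proof
    fix d assume "d \<in> edges F"
    then obtain e' where e': "e' \<in> edges (H i)" "d = h ` e'"
      unfolding F_def by auto
    then have "e' \<subseteq> verts (H i)" "card e' = 2" "finite e'"
      using assms(1) unfolding finite_simple_graph_def nsets_def by auto
    then show "d \<in> edges (complete_graph n)"
      using e' ran inj unfolding complete_graph_def nsets_def
      by (auto simp: card_image inj_on_subset)
  qed
  ultimately have "copy_in F (H i) (complete_graph n)"
    unfolding copy_in_def using ran by (auto simp: F_def complete_graph_def)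
  moreover have "h ` e \<in> edges F" "\<forall>d\<in>edges F. \<phi> d = i"
    using assms(6) mono unfolding F_def by auto
  ultimately show ?thesis
    unfolding nim_edge_def using assms(2) by blast
qed

lemma finite_simple_graph_edgeE:
  assumes "finite_simple_graph G" "e \<in> edges G"
  obtains u v where "e = {u, v}" "u \<noteq> v" "u \<in> verts G" "v \<in> verts G"
proof -
  have "e \<in> nsets (verts G) 2"
    using assms unfolding finite_simple_graph_def by auto
  then show thesis
    using that by (elim nsets2_E) auto
qed

lemma edges_nonempty_if_not_bipartite:
  "\<not> bipartite G \<Longrightarrow> edges G \<noteq> {}"
  unfolding bipartite_def by (metis Int_empty_right Un_empty_right empty_iff)

text \<open>Any violation of (P1) or (P2) would put a NIM-edge into a monochromatic copy of some
  \<open>H i\<close>. A homomorphism into colour \<open>i\<close> lifts to an embedding into the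
  blow-up all of whose edges run between parts. If \<open>\<xi> {a, p} = \<xi> {a}\<close>, then
  part \<open>a\<close> together with one vertex of part \<open>p\<close> is a monochromatic clique
  with room for \<open>H i\<close>, and its edges at the extra vertex are NIM-edges.\<close>

lemma feasible_if_nim_blowup:
  assumes fin: "\<And>i. i \<in> {1..k} \<Longrightarrow> finite_simple_graph (H i)"
    and ne: "\<And>i. i \<in> {1..k} \<Longrightarrow> edges (H i) \<noteq> {}"
    and q: "\<And>i. i \<in> {1..k} \<Longrightarrow> card (verts (H i)) \<le> q"
    and \<xi>: "\<xi> \<in> {A. A \<subseteq> {1..s} \<and> card A \<le> 2} \<rightarrow> {1..k}"
    and b_ran: "\<And>p t. p \<in> {1..s} \<Longrightarrow> t < q \<Longrightarrow> b p t \<in> {1..n}"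
    and b_inj: "\<And>p t t'. p \<in> {1..s} \<Longrightarrow> t < q \<Longrightarrow> t' < q \<Longrightarrow> t \<noteq> t' \<Longrightarrow> b p t \<noteq> b p t'"
    and b_nim: "\<And>p p' t t'. p \<in> {1..s} \<Longrightarrow> p' \<in> {1..s} \<Longrightarrow> p \<noteq> p' \<Longrightarrow> t < q \<Longrightarrow> t' < q \<Longrightarrow>
      nim_edge n k H \<phi> {b p t, b p' t'}"
    and b_cross: "\<And>p p' t t'. p \<in> {1..s} \<Longrightarrow> p' \<in> {1..s} \<Longrightarrow> p \<noteq> p' \<Longrightarrow> t < q \<Longrightarrow> t' < q \<Longrightarrow>
      \<phi> {b p t, b p' t'} = \<xi> {p, p'}"
    and b_in: "\<And>p t t'. p \<in> {1..s} \<Longrightarrow> t < q \<Longrightarrow> t' < q \<Longrightarrow> t \<noteq> t' \<Longrightarrow> \<phi> {b p t, b p t'} = \<xi> {p}"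
  shows "feasible s k H \<xi>"
proof -
  have "\<exists>g. inj_on g (verts (H i)) \<and> g ` verts (H i) \<subseteq> {..<q}" if "i \<in> {1..k}" for i
    using fin[OF that] q[OF that] inj_on_iff_card_le[of "verts (H i)" "{..<q}"]
    by (auto simp: finite_simple_graph_def)
  then obtain g where g: "\<And>i. i \<in> {1..k} \<Longrightarrow> inj_on (g i) (verts (H i))"
    "\<And>i. i \<in> {1..k} \<Longrightarrow> g i ` verts (H i) \<subseteq> {..<q}"
    by metis
  have gq: "g i v < q" if "i \<in> {1..k}" "v \<in> verts (H i)" for i v
    using g(2)[OF that(1)] that(2) by auto
  have neq: "b p t \<noteq> b p' t'" if "p \<in> {1..s}" "p' \<in> {1..s}" "p \<noteq> p'" "t < q" "t' < q" for p p' t t'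
    using b_nim[OF that] by (auto simp: nim_edge_def complete_graph_def nsets_def)
  have P1: "\<not> graph_hom f (H i) ({1..s}, {e \<in> nsets {1..s} 2. \<xi> e = i})" if i: "i \<in> {1..k}" for i f
  proof
    assume hom: "graph_hom f (H i) ({1..s}, {e \<in> nsets {1..s} 2. \<xi> e = i})"
    then have fr: "f v \<in> {1..s}" if "v \<in> verts (H i)" for v
      using that unfolding graph_hom_def by auto
    have fe: "f ` e \<in> nsets {1..s} 2" "\<xi> (f ` e) = i" if "e \<in> edges (H i)" for e
      using hom that unfolding graph_hom_def by auto
    \<comment> \<open>The second index \<open>g i v\<close> separates vertices that \<open>f\<close>
      identifies.\<close>
    define h where "h v = b (f v) (g i v)" for v
    have inj: "inj_on h (verts (H i))"
    proof (rule inj_onI, rule ccontr)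
      fix v w assume vw: "v \<in> verts (H i)" "w \<in> verts (H i)" "h v = h w" "v \<noteq> w"
      then have "g i v \<noteq> g i w"
        using g(1)[OF i] by (auto simp: inj_on_def)
      then show False
        using vw(3) neq[OF fr[OF vw(1)] fr[OF vw(2)]] b_inj[OF fr[OF vw(1)]] gq[OF i] vw(1,2)
        unfolding h_def by (cases "f v = f w") auto
    qed
    have ran: "h ` verts (H i) \<subseteq> {1..n}"
      unfolding h_def using b_ran fr gq[OF i] by blast
    have e_split: "\<exists>v w. e = {v, w} \<and> v \<in> verts (H i) \<and> w \<in> verts (H i) \<and> f v \<noteq> f w"
      if e: "e \<in> edges (H i)" for e
    proof -
      obtain v w where vw: "e = {v, w}" "v \<noteq> w" "v \<in> verts (H i)" "w \<in> verts (H i)"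
        using finite_simple_graph_edgeE[OF fin[OF i] e] by blast
      moreover have "f v \<noteq> f w"
        using fe(1)[OF e] vw by (auto simp: nsets_def)
      ultimately show ?thesis by blast
    qed
    have mono: "\<phi> (h ` e) = i" if e: "e \<in> edges (H i)" for e
    proof -
      obtain v w where vw: "e = {v, w}" "v \<in> verts (H i)" "w \<in> verts (H i)" "f v \<noteq> f w"
        using e_split[OF e] by blast
      have "\<phi> {b (f v) (g i v), b (f w) (g i w)} = \<xi> {f v, f w}"
        using vw by (intro b_cross fr gq[OF i])
      then show ?thesis
        using fe(2)[OF e] vw(1) unfolding h_def by simp
    qed
    obtain e where e: "e \<in> edges (H i)"
      using ne[OF i] by blast
    obtain v w where vw: "e = {v, w}" "v \<in> verts (H i)" "w \<in> verts (H i)" "f v \<noteq> f w"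
      using e_split[OF e] by blast
    have "nim_edge n k H \<phi> {b (f v) (g i v), b (f w) (g i w)}"
      using vw by (intro b_nim fr gq[OF i])
    then show False
      using not_nim_edge_if_monochromatic_copy[where h = h and \<phi> = \<phi> and H = H and i = i, OF fin[OF i] i inj ran mono e] vw(1)
      unfolding h_def by simp
  qed
  have P2: "\<xi> {a, p} \<noteq> \<xi> {a}" if a: "a \<in> {1..s}" and p: "p \<in> {1..s}" and ap: "a \<noteq> p" for a p
  proof
    assume eq: "\<xi> {a, p} = \<xi> {a}"
    define i where "i = \<xi> {a}"
    have i: "i \<in> {1..k}"
      unfolding i_def using \<xi> a by (auto simp: Pi_iff)
    obtain e where e: "e \<in> edges (H i)"
      using ne[OF i] by blast
    obtain u v where uv: "e = {u, v}" "u \<noteq> v" "u \<in> verts (H i)" "v \<in> verts (H i)"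
      using finite_simple_graph_edgeE[OF fin[OF i] e] by blast
    have q0: "0 < q"
      using gq[OF i uv(3)] by simp
    \<comment> \<open>Only the endpoint \<open>u\<close> of the chosen edge moves to part
      \<open>p\<close>, so that this edge is mapped to a NIM-edge.\<close>
    define h where "h w = (if w = u then b p 0 else b a (g i w))" for w
    have inj: "inj_on h (verts (H i))"
    proof (rule inj_onI, rule ccontr)
      fix x y assume xy: "x \<in> verts (H i)" "y \<in> verts (H i)" "h x = h y" "x \<noteq> y"
      then have "g i x \<noteq> g i y"
        using g(1)[OF i] by (auto simp: inj_on_def)
      then show False
        using xy(3,4) neq[OF a p ap _ q0] b_inj[OF a] gq[OF i xy(1)] gq[OF i xy(2)]
        unfolding h_def by (auto split: if_splits)
    qed
    have ran: "h ` verts (H i) \<subseteq> {1..n}"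
      using b_ran[OF a] b_ran[OF p] q0 gq[OF i] unfolding h_def by (simp add: image_subset_iff)
    have mono: "\<phi> (h ` e') = i" if e': "e' \<in> edges (H i)" for e'
    proof -
      obtain x y where xy: "e' = {x, y}" "x \<noteq> y" "x \<in> verts (H i)" "y \<in> verts (H i)"
        using finite_simple_graph_edgeE[OF fin[OF i] e'] by blast
      have gxy: "g i x \<noteq> g i y"
        using g(1)[OF i] xy by (auto simp: inj_on_def)
      have cr: "\<phi> {b a (g i w), b p 0} = i" if "w \<in> verts (H i)" for w
        using b_cross[OF a p ap gq[OF i that] q0] eq by (simp add: i_def)
      have "h ` e' = {h x, h y}"
        by (simp add: xy(1))
      then show ?thesis
        using b_in[OF a gq[OF i xy(3)] gq[OF i xy(4)] gxy] cr[OF xy(3)] cr[OF xy(4)] xy(2)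
        by (auto simp: h_def i_def insert_commute)
    qed
    have "nim_edge n k H \<phi> {b p 0, b a (g i v)}"
      using b_nim[OF p a _ q0 gq[OF i uv(4)]] ap by auto
    then show False
      using not_nim_edge_if_monochromatic_copy[where h = h and \<phi> = \<phi> and H = H and i = i, OF fin[OF i] i inj ran mono e] uv
      unfolding h_def by (auto simp: insert_commute)
  qed
  show ?thesis
    unfolding feasible_def using \<xi> P1 P2 by auto
qed

lemma listset_iff: "xs \<in> listset As \<longleftrightarrow> length xs = length As \<and> (\<forall>i<length As. xs ! i \<in> As ! i)"
proof (induction As arbitrary: xs)
  case (Cons A As)
  then show ?case
    by (cases xs) (auto simp: set_Cons_def less_Suc_eq_0_disj)
qed auto

text \<open>Completing \<open>x\<close> and \<open>y\<close> by arbitrary elements of the other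
  parts gives a member of the box; this is where nonempty parts enter.\<close>

lemma adj_if_listset_subset_cliques:
  assumes sub: "listset As \<subseteq> cliques adj V s" and ne: "\<And>A. A \<in> set As \<Longrightarrow> A \<noteq> {}"
    and len: "length As = s" and ij: "i < j" "j < s" and x: "x \<in> As ! i" and y: "y \<in> As ! j"
  shows "adj x y"
proof -
  define xs where "xs = map (\<lambda>l. if l = i then x else if l = j then y else SOME z. z \<in> As ! l) [0..<s]"
  have "(SOME z. z \<in> As ! l) \<in> As ! l" if "l < s" for l
    using ne[of "As ! l"] that len by (auto simp: some_in_eq)
  then have "xs \<in> listset As"
    using x y len by (auto simp: listset_iff xs_def)
  then have "sorted_wrt adj xs"
    using sub by (auto simp: cliques_def)
  then have "adj (xs ! i) (xs ! j)"
    using sorted_wrt_nth_less[of adj xs i j] ij by (simp add: xs_def)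
  then show ?thesis
    using ij by (simp add: xs_def)
qed

lemma colour_mem:
  assumes "edge_colouring n k \<phi>" "x \<in> {1..n}" "y \<in> {1..n}" "x \<noteq> y"
  shows "\<phi> {x, y} \<in> {1..k}"
  using assms by (auto simp: edge_colouring_def Pi_iff)

lemma nim_edgeD:
  assumes "nim_edge n k H \<phi> {x, y}"
  shows "x \<in> {1..n}" "y \<in> {1..n}" "x \<noteq> y"
  using assms by (auto simp: nim_edge_def complete_graph_def)

text \<open>Colouring a pair \<open>t < t'\<close> of indices by all the colours between the \<open>t\<close>-th vertex of one part
  and the \<open>t'\<close>-th vertex of another, one application of Ramsey's theorem makes all parts and all
  pairs of parts monochromatic, once consecutive blocks of indices are used for the parts.\<close>
lemma feasible_if_nim_multipartite:
  fixes H :: "nat \<Rightarrow> 'a sgraph"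
  assumes "k \<ge> 1" and fin: "\<And>i. i \<in> {1..k} \<Longrightarrow> finite_simple_graph (H i)"
    and ne: "\<And>i. i \<in> {1..k} \<Longrightarrow> edges (H i) \<noteq> {}"
  shows "\<exists>M. \<forall>n \<phi> As. edge_colouring n k \<phi> \<longrightarrow> length As = s \<longrightarrow>
    (\<forall>A\<in>set As. A \<subseteq> {1..n} \<and> card A = M) \<longrightarrow>
    listset As \<subseteq> cliques (\<lambda>x y. nim_edge n k H \<phi> {x, y}) {1..n} s \<longrightarrow> (\<exists>\<xi>. feasible s k H \<xi>)"
proof -
  \<comment> \<open>The sum bounds all the orders at once. The \<open>+ 2\<close> guarantees two
    indices, from which the common value \<open>c\<close> is seen to be a genuine table of
    colours.\<close>
  define q where "q = (\<Sum>i\<in>{1..k}. card (verts (H i))) + 2"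
  have q: "card (verts (H i)) \<le> q" if "i \<in> {1..k}" for i
    using member_le_sum[OF that, of "\<lambda>i. card (verts (H i))"] unfolding q_def by simp
  define P where "P = {1..s} \<times> {1..s}"
  have finP: "finite (PiE P (\<lambda>_. {1..k}))"
    unfolding P_def by (intro finite_PiE) auto
  \<comment> \<open>Part \<open>p\<close> will own the indices from \<open>p * q\<close> to
    \<open>p * q + q - 1\<close>. Parts are numbered from 1 to \<open>s\<close>, so
    \<open>Suc s\<close> blocks are reserved.\<close>
  obtain M :: nat where M: "\<forall>f. (\<forall>i j. i < j \<longrightarrow> j < M \<longrightarrow> f i j \<in> PiE P (\<lambda>_. {1..k})) \<longrightarrow>
    (\<exists>(e :: nat \<Rightarrow> nat) c. (\<forall>t<Suc s * q. e t < M) \<and>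
      (\<forall>t t'. t < t' \<longrightarrow> t' < Suc s * q \<longrightarrow> e t < e t' \<and> f (e t) (e t') = c))"
    using ramsey_pairs[OF finP, of "Suc s * q"] by (elim exE) (rule that)
  show ?thesis
  \<comment> \<open>The extra vertex makes the parts visibly nonempty.\<close>
  proof (intro exI[of _ "M + 1"] allI impI)
    fix n \<phi> and As :: "nat set list"
    assume col: "edge_colouring n k \<phi>" and len: "length As = s"
      and As: "\<forall>A\<in>set As. A \<subseteq> {1..n} \<and> card A = M + 1"
      and sub: "listset As \<subseteq> cliques (\<lambda>x y. nim_edge n k H \<phi> {x, y}) {1..n} s"
    have As_nth: "As ! (p - 1) \<subseteq> {1..n}" "card (As ! (p - 1)) = M + 1" if "p \<in> {1..s}" for p
      using As that len nth_mem[of "p - 1" As] by auto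
    have "\<exists>a. inj_on a {..<M + 1} \<and> a ` {..<M + 1} \<subseteq> As ! (p - 1)" if "p \<in> {1..s}" for p
      using As_nth[OF that] inj_on_iff_card_le[of "{..<M + 1}" "As ! (p - 1)"]
        finite_subset[of _ "{1..n}"] by auto
    then obtain a where a_inj: "\<And>p. p \<in> {1..s} \<Longrightarrow> inj_on (a p) {..<M + 1}"
      and a_img: "\<And>p. p \<in> {1..s} \<Longrightarrow> a p ` {..<M + 1} \<subseteq> As ! (p - 1)"
      by metis
    have a_in: "a p t \<in> As ! (p - 1)" if "p \<in> {1..s}" "t < M" for p t
      using a_img[OF that(1)] that(2) by (auto simp: image_subset_iff)
    have a_n: "a p t \<in> {1..n}" if "p \<in> {1..s}" "t < M" for p t
      using a_in[OF that] As_nth(1)[OF that(1)] by blast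
    have a_nim_less: "nim_edge n k H \<phi> {a p t, a p' t'}"
      if "p \<in> {1..s}" "p' \<in> {1..s}" "p < p'" "t < M" "t' < M" for p p' t t'
      by (rule adj_if_listset_subset_cliques[OF sub _ len, of "p - 1" "p' - 1"])
         (use As that a_in in auto)
    have a_nim: "nim_edge n k H \<phi> {a p t, a p' t'}"
      if "p \<in> {1..s}" "p' \<in> {1..s}" "p \<noteq> p'" "t < M" "t' < M" for p p' t t'
      using a_nim_less[of p p' t t'] a_nim_less[of p' p t' t] that
      by (cases "p < p'") (auto simp: insert_commute)
    have a_neq: "a p t \<noteq> a p' t'"
      if "p \<in> {1..s}" "p' \<in> {1..s}" "t < M" "t' < M" "t \<noteq> t'" for p p' t t'
    proof (cases "p = p'")
      case True
      then show ?thesis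
        using inj_onD[OF a_inj[OF that(1)], of t t'] that by auto
    next
      case False
      then show ?thesis
        using nim_edgeD(3)[OF a_nim[OF that(1,2) False that(3,4)]] by simp
    qed
    define f where "f t t' = restrict (\<lambda>(p, p'). \<phi> {a p t, a p' t'}) P" for t t'
    have fP: "f t t' \<in> PiE P (\<lambda>_. {1..k})" if "t < t'" "t' < M" for t t'
    proof -
      have "\<phi> {a p t, a p' t'} \<in> {1..k}" if "p \<in> {1..s}" "p' \<in> {1..s}" for p p'
        using that \<open>t < t'\<close> \<open>t' < M\<close> by (intro colour_mem[OF col] a_n a_neq) auto
      then show "f t t' \<in> PiE P (\<lambda>_. {1..k})"
        unfolding f_def P_def by auto
    qed
    then have "\<exists>(e :: nat \<Rightarrow> nat) c. (\<forall>t<Suc s * q. e t < M) \<and>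
      (\<forall>t t'. t < t' \<longrightarrow> t' < Suc s * q \<longrightarrow> e t < e t' \<and> f (e t) (e t') = c)"
      by (intro M[rule_format])
    then obtain e :: "nat \<Rightarrow> nat" and c where e: "\<And>t. t < Suc s * q \<Longrightarrow> e t < M"
      and c: "\<And>t t'. t < t' \<Longrightarrow> t' < Suc s * q \<Longrightarrow> e t < e t' \<and> f (e t) (e t') = c"
      by blast
    have sq: "1 < Suc s * q"
      unfolding q_def by simp
    have cP: "c \<in> PiE P (\<lambda>_. {1..k})"
      using fP[of "e 0" "e 1"] c[of 0 1] sq e[OF sq] by auto
    have ck: "c (p, p') \<in> {1..k}" if "p \<in> {1..s}" "p' \<in> {1..s}" for p p'
      using PiE_mem[OF cP] that unfolding P_def by simp
    \<comment> \<open>\<open>c (p, p')\<close> and \<open>c (p', p)\<close> may differ: the former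
      is the colour seen when the index in part \<open>p\<close> is the smaller one. Consecutive
      blocks give the smaller part the smaller indices, so \<open>(Min A, Max A)\<close> is the
      correct entry, and a singleton reads the diagonal. The empty set also belongs to the domain
      and gets the default colour 1.\<close>
    define \<xi> where "\<xi> A = (if A = {} then 1 else c (Min A, Max A))" for A :: "nat set"
    have \<xi>: "\<xi> \<in> {A. A \<subseteq> {1..s} \<and> card A \<le> 2} \<rightarrow> {1..k}"
    proof
      fix A assume "A \<in> {A. A \<subseteq> {1..s} \<and> card A \<le> 2}"
      then have A: "A \<subseteq> {1..s}" "finite A"
        using finite_subset[of A "{1..s}"] by auto
      show "\<xi> A \<in> {1..k}"
      proof (cases "A = {}")
        case False
        then have "Min A \<in> {1..s}" "Max A \<in> {1..s}"
          using A Min_in[of A] Max_in[of A] by blast+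
        then show ?thesis
          using ck False by (simp add: \<xi>_def)
      qed (use \<open>k \<ge> 1\<close> in \<open>simp add: \<xi>_def\<close>)
    qed
    define b where "b p t = a p (e (p * q + t))" for p t
    have idx: "p * q + t < Suc s * q" if "p \<in> {1..s}" "t < q" for p t
    proof -
      have "p * q + t < Suc p * q" using that by simp
      also have "\<dots> \<le> Suc s * q" using that by (intro mult_le_mono1) simp
      finally show ?thesis .
    qed
    have idx_less: "p * q + t < p' * q + t'" if "p < p'" "t < q" for p p' t t'
    proof -
      have "p * q + t < Suc p * q" using that by simp
      also have "\<dots> \<le> p' * q" using that by (intro mult_le_mono1) simp
      finally show ?thesis by simp
    qed
    have eM: "e (p * q + t) < M" if "p \<in> {1..s}" "t < q" for p t
      using e[OF idx[OF that]] .
    have col_less: "\<phi> {b p t, b p' t'} = c (p, p')"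
      if "p \<in> {1..s}" "p' \<in> {1..s}" "t < q" "t' < q" "p * q + t < p' * q + t'" for p p' t t'
    proof -
      have "f (e (p * q + t)) (e (p' * q + t')) = c"
        using c[OF that(5) idx[OF that(2,4)]] by simp
      then have "c (p, p') = f (e (p * q + t)) (e (p' * q + t')) (p, p')"
        by simp
      then show ?thesis
        using that(1,2) by (simp add: f_def P_def b_def)
    qed
    have cross_less: "\<phi> {b p t, b p' t'} = \<xi> {p, p'}"
      if "p \<in> {1..s}" "p' \<in> {1..s}" "t < q" "t' < q" "p < p'" for p p' t t'
      using col_less[OF that(1-4) idx_less[OF that(5,3)]] that(5) by (simp add: \<xi>_def min_def max_def)
    have in_less: "\<phi> {b p t, b p t'} = \<xi> {p}"
      if "p \<in> {1..s}" "t < q" "t' < q" "t < t'" for p t t'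
      using col_less[OF that(1,1,2,3)] that(4) by (simp add: \<xi>_def)
    have "feasible s k H \<xi>"
    proof (rule feasible_if_nim_blowup[where b = b and q = q and n = n and \<phi> = \<phi>, OF fin ne q \<xi>])
      show "b p t \<in> {1..n}" if "p \<in> {1..s}" "t < q" for p t
        using a_n eM that unfolding b_def by blast
      show "b p t \<noteq> b p t'" if "p \<in> {1..s}" "t < q" "t' < q" "t \<noteq> t'" for p t t'
      proof -
        have "e (p * q + t) \<noteq> e (p * q + t')"
          using c[of "p * q + t" "p * q + t'"] c[of "p * q + t'" "p * q + t"] idx that
          by (cases "t < t'") (auto dest: less_not_refl2)
        then show ?thesis
          using a_neq eM that unfolding b_def by blast
      qed
      show "nim_edge n k H \<phi> {b p t, b p' t'}"
        if "p \<in> {1..s}" "p' \<in> {1..s}" "p \<noteq> p'" "t < q" "t' < q" for p p' t t'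
        using a_nim eM that unfolding b_def by blast
      show "\<phi> {b p t, b p' t'} = \<xi> {p, p'}"
        if "p \<in> {1..s}" "p' \<in> {1..s}" "p \<noteq> p'" "t < q" "t' < q" for p p' t t'
        using cross_less[of p p' t t'] cross_less[of p' p t' t] that
        by (cases "p < p'") (auto simp: insert_commute)
      show "\<phi> {b p t, b p t'} = \<xi> {p}" if "p \<in> {1..s}" "t < q" "t' < q" "t \<noteq> t'" for p t t'
        using in_less[of p t t'] in_less[of p t' t] that
        by (cases "t < t'") (auto simp: insert_commute)
    qed
    then show "\<exists>\<xi>. feasible s k H \<xi>"
      by blast
  qed
qed

section \<open>Boundedness and positivity of \<open>r_star\<close>\<close>

text \<open>Among too many points Ramsey's theorem finds \<open>q\<close> points all of whose pairs
  have one colour \<open>c\<close>, and an injection of the vertices of \<open>H c\<close> into them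
  violates (P1). This makes the \<open>GREATEST\<close> in \<open>r_star\<close> an actual maximum
  once some order is feasible.\<close>

lemma feasible_bounded:
  fixes H :: "nat \<Rightarrow> 'a sgraph"
  assumes "k \<ge> 1" and fin: "\<And>i. i \<in> {1..k} \<Longrightarrow> finite_simple_graph (H i)"
  shows "\<exists>N. \<forall>r \<xi>. feasible r k H \<xi> \<longrightarrow> r \<le> N"
proof -
  define q where "q = (\<Sum>i\<in>{1..k}. card (verts (H i))) + 2"
  have q: "card (verts (H i)) \<le> q" if "i \<in> {1..k}" for i
    using member_le_sum[OF that, of "\<lambda>i. card (verts (H i))"] unfolding q_def by simp
  obtain N :: nat where N: "\<forall>f. (\<forall>i j. i < j \<longrightarrow> j < N \<longrightarrow> f i j \<in> {1..k}) \<longrightarrow>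
    (\<exists>(e :: nat \<Rightarrow> nat) c. (\<forall>t<q. e t < N) \<and>
      (\<forall>t t'. t < t' \<longrightarrow> t' < q \<longrightarrow> e t < e t' \<and> f (e t) (e t') = c))"
    using ramsey_pairs[of "{1..k}" q] by (elim meta_impE exE) (simp, rule that)
  have "\<not> feasible r k H \<xi>" if r: "N < r" for r \<xi>
  proof
    assume feas: "feasible r k H \<xi>"
    define f where "f i j = \<xi> {Suc i, Suc j}" for i j
    have fk: "f i j \<in> {1..k}" if "i < j" "j < N" for i j
    proof -
      have "{Suc i, Suc j} \<in> {A. A \<subseteq> {1..r} \<and> card A \<le> 2}"
        using that r by auto
      then show ?thesis
        using feas unfolding feasible_def f_def by blast
    qed
    then have "\<exists>(e :: nat \<Rightarrow> nat) c. (\<forall>t<q. e t < N) \<and>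
      (\<forall>t t'. t < t' \<longrightarrow> t' < q \<longrightarrow> e t < e t' \<and> f (e t) (e t') = c)"
      by (intro N[rule_format])
    then obtain e :: "nat \<Rightarrow> nat" and c where e: "\<And>t. t < q \<Longrightarrow> e t < N"
      and c: "\<And>t t'. t < t' \<Longrightarrow> t' < q \<Longrightarrow> e t < e t' \<and> f (e t) (e t') = c"
      by blast
    have q2: "1 < q" unfolding q_def by simp
    have ck: "c \<in> {1..k}"
      using fk[of "e 0" "e 1"] c[of 0 1] e[OF q2] q2 by auto
    obtain g where g: "inj_on g (verts (H c))" "g ` verts (H c) \<subseteq> {..<q}"
      using fin[OF ck] q[OF ck] inj_on_iff_card_le[of "verts (H c)" "{..<q}"]
      by (auto simp: finite_simple_graph_def)
    define h where "h v = Suc (e (g v))" for v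
    have "graph_hom h (H c) ({1..r}, {e \<in> nsets {1..r} 2. \<xi> e = c})"
      unfolding graph_hom_def
    proof (intro conjI ballI)
      have hr: "h v \<in> {1..r}" if "v \<in> verts (H c)" for v
        using that g(2) e[of "g v"] r unfolding h_def by auto
      then show "h \<in> verts (H c) \<rightarrow> verts ({1..r}, {e \<in> nsets {1..r} 2. \<xi> e = c})"
        by simp
      fix d assume d: "d \<in> edges (H c)"
      obtain u v where uv: "d = {u, v}" "u \<noteq> v" "u \<in> verts (H c)" "v \<in> verts (H c)"
        using finite_simple_graph_edgeE[OF fin[OF ck] d] by blast
      have guv: "g u < q" "g v < q" "g u \<noteq> g v"
        using g uv by (auto simp: inj_on_def)
      then have "h u \<noteq> h v \<and> \<xi> {h u, h v} = c"
        using c[of "g u" "g v"] c[of "g v" "g u"] unfolding h_def f_def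
        by (cases "g u < g v") (auto simp: insert_commute)
      then show "h ` d \<in> edges ({1..r}, {e \<in> nsets {1..r} 2. \<xi> e = c})"
        using hr uv by simp
    qed
    then show False
      using feas ck unfolding feasible_def by blast
  qed
  then show ?thesis
    by (meson not_le)
qed

lemma feasible_le_r_star:
  assumes "k \<ge> 1" "\<And>i. i \<in> {1..k} \<Longrightarrow> finite_simple_graph (H i)" "feasible r k H \<xi>"
  shows "r \<le> r_star k H"
proof -
  obtain N where "\<And>r \<xi>. feasible r k H \<xi> \<Longrightarrow> r \<le> N"
    using feasible_bounded[of k H] assms(1,2) by blast
  then show ?thesis
    unfolding r_star_def using assms(3) by (intro Greatest_le_nat[where b = N]) auto
qed

lemma r_star_pos:
  assumes "k \<ge> 1" "\<And>i. i \<in> {1..k} \<Longrightarrow> finite_simple_graph (H i)"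
    and "\<And>i. i \<in> {1..k} \<Longrightarrow> edges (H i) \<noteq> {}"
  shows "r_star k H \<ge> 1"
proof -
  have "nsets {1..1::nat} 2 = {}"
    by (simp add: nsets_eq_empty)
  then have "feasible 1 k H (\<lambda>_. 1)"
    using assms unfolding feasible_def graph_hom_def by fastforce
  then show ?thesis
    using feasible_le_r_star[of k H 1] assms(1,2) by blast
qed

section \<open>From a nearly extremal partition to the edit distance\<close>

text \<open>For each label match as many vertices as the smaller of the two classes allows, and
  extend by any bijection of the leftovers, which have equal size. Only the surplus of a
  \<open>g\<close>-class over the corresponding \<open>f\<close>-class can be mislabelled; the
  truncated subtraction is exactly this surplus.\<close>

lemma bij_matching_labels:
  assumes V: "finite V" and J: "finite J" and f: "f ` V \<subseteq> J" and g: "g ` V \<subseteq> J"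
  shows "\<exists>\<sigma>. bij_betw \<sigma> V V \<and> card {x \<in> V. f (\<sigma> x) \<noteq> g x}
    \<le> (\<Sum>j\<in>J. card {x \<in> V. g x = j} - card {x \<in> V. f x = j})"
proof -
  define F where "F j = {x \<in> V. f x = j}" for j
  define G where "G j = {x \<in> V. g x = j}" for j
  have fin: "finite (F j)" "finite (G j)" for j
    unfolding F_def G_def using V by auto
  have "\<exists>U W h. U \<subseteq> G j \<and> W \<subseteq> F j \<and> card U = min (card (G j)) (card (F j)) \<and> bij_betw h U W" for j
  proof -
    obtain U where U: "U \<subseteq> G j" "card U = min (card (G j)) (card (F j))" "finite U"
      using obtain_subset_with_card_n[of "min (card (G j)) (card (F j))" "G j"] by auto
    obtain W where W: "W \<subseteq> F j" "card W = min (card (G j)) (card (F j))" "finite W"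
      using obtain_subset_with_card_n[of "min (card (G j)) (card (F j))" "F j"] by auto
    then show ?thesis
      using U finite_same_card_bij[of U W] by auto
  qed
  then obtain U W h where U: "\<And>j. U j \<subseteq> G j" and W: "\<And>j. W j \<subseteq> F j"
    and cU: "\<And>j. card (U j) = min (card (G j)) (card (F j))" and h: "\<And>j. bij_betw (h j) (U j) (W j)"
    by metis
  define UU where "UU = (\<Union>j\<in>J. U j)"
  define WW where "WW = (\<Union>j\<in>J. W j)"
  define H where "H x = h (g x) x" for x
  have gU: "g x = j" if "x \<in> U j" for x j
    using U[of j] that by (auto simp: G_def)
  have fW: "f x = j" if "x \<in> W j" for x j
    using W[of j] that by (auto simp: F_def)
  have HW: "H x \<in> W j" if "x \<in> U j" for x j
    using h[of j] that gU[OF that] unfolding H_def by (auto simp: bij_betw_def)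
  have "inj_on H UU"
  proof (rule inj_onI)
    fix x y assume "x \<in> UU" "y \<in> UU" and eq: "H x = H y"
    then obtain i j where ij: "x \<in> U i" "y \<in> U j"
      by (auto simp: UU_def)
    then have "i = j"
      using fW[OF HW[OF ij(1)]] fW[OF HW[OF ij(2)]] eq by simp
    then show "x = y"
      using ij eq h[of j] gU unfolding H_def bij_betw_def by (metis inj_onD)
  qed
  moreover have "H ` UU = WW"
  proof (intro subset_antisym subsetI)
    fix y assume "y \<in> WW"
    then obtain j where j: "j \<in> J" "y \<in> W j"
      by (auto simp: WW_def)
    then obtain x where "x \<in> U j" "y = h j x"
      using h[of j] by (auto simp: bij_betw_def)
    then show "y \<in> H ` UU"
      using gU j unfolding H_def UU_def by force
  qed (use HW in \<open>auto simp: UU_def WW_def\<close>)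
  ultimately have HB: "bij_betw H UU WW"
    by (simp add: bij_betw_def)
  have UV: "UU \<subseteq> V" and WV: "WW \<subseteq> V"
    using U W by (auto simp: UU_def WW_def G_def F_def)
  have "card (V - UU) = card (V - WW)"
    using bij_betw_same_card[OF HB] UV WV V by (simp add: card_Diff_subset finite_subset)
  then obtain K where K: "bij_betw K (V - UU) (V - WW)"
    using finite_same_card_bij[of "V - UU" "V - WW"] V by auto
  define \<sigma> where "\<sigma> x = (if x \<in> UU then H x else K x)" for x
  have "bij_betw \<sigma> UU WW" "bij_betw \<sigma> (V - UU) (V - WW)"
    using HB K bij_betw_cong[of UU \<sigma> H] bij_betw_cong[of "V - UU" \<sigma> K] by (auto simp: \<sigma>_def)
  then have "bij_betw \<sigma> (UU \<union> (V - UU)) (WW \<union> (V - WW))"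
    by (rule bij_betw_combine) auto
  then have \<sigma>: "bij_betw \<sigma> V V"
    using UV WV by (simp add: Un_absorb1)
  have "{x \<in> V. f (\<sigma> x) \<noteq> g x} \<subseteq> (\<Union>j\<in>J. G j - U j)"
  proof
    fix x assume x: "x \<in> {x \<in> V. f (\<sigma> x) \<noteq> g x}"
    have "x \<notin> U (g x)"
    proof
      assume "x \<in> U (g x)"
      moreover have "g x \<in> J" using x g by auto
      ultimately have "\<sigma> x = H x" "H x \<in> W (g x)"
        using HW by (auto simp: \<sigma>_def UU_def)
      then show False
        using fW x by auto
    qed
    then show "x \<in> (\<Union>j\<in>J. G j - U j)"
      using x g by (auto simp: G_def)
  qed
  then have "card {x \<in> V. f (\<sigma> x) \<noteq> g x} \<le> card (\<Union>j\<in>J. G j - U j)"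
    using J fin by (intro card_mono) auto
  also have "\<dots> \<le> (\<Sum>j\<in>J. card (G j - U j))"
    by (rule card_UN_le[OF J])
  also have "\<dots> = (\<Sum>j\<in>J. card (G j) - card (F j))"
    using card_Diff_subset[OF finite_subset[OF U fin(2)] U] cU by (intro sum.cong) (auto simp: min_def)
  finally show ?thesis
    using \<sigma> by (auto simp: F_def G_def)
qed

lemma edit_distance_le:
  assumes fin: "finite (verts G)" and G: "edges G \<subseteq> Pow (verts G)" and H: "edges H \<subseteq> Pow (verts H)"
    and \<sigma>: "bij_betw \<sigma> (verts H) (verts G)"
  shows "edit_distance G H \<le> card (sym_diff (edges G) ((\<lambda>e. \<sigma> ` e) ` edges H))"
  unfolding edit_distance_def
proof (rule Min_le)
  show "finite {card (sym_diff (edges G) ((\<lambda>e. \<sigma> ` e) ` edges H)) |\<sigma>. bij_betw \<sigma> (verts H) (verts G)}"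
  proof (rule finite_subset)
    show "{card (sym_diff (edges G) ((\<lambda>e. \<sigma> ` e) ` edges H)) |\<sigma>. bij_betw \<sigma> (verts H) (verts G)}
      \<subseteq> {..card (Pow (verts G))}"
    proof
      fix c assume "c \<in> {card (sym_diff (edges G) ((\<lambda>e. \<sigma> ` e) ` edges H)) |\<sigma>. bij_betw \<sigma> (verts H) (verts G)}"
      then obtain \<tau> where \<tau>: "bij_betw \<tau> (verts H) (verts G)"
        and c: "c = card (sym_diff (edges G) ((\<lambda>e. \<tau> ` e) ` edges H))"
        by blast
      from \<tau> have "sym_diff (edges G) ((\<lambda>e. \<tau> ` e) ` edges H) \<subseteq> Pow (verts G)"
        using G H by (fastforce simp: bij_betw_def)
      then show "c \<in> {..card (Pow (verts G))}"
        unfolding c atMost_iff using fin by (intro card_mono) simp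
    qed
  qed simp
qed (use \<sigma> in auto)

text \<open>Within a residue class \<open>x\<close> is determined by \<open>x div r\<close>, which
  takes at most \<open>n div r + 1\<close> values.\<close>

lemma card_residue_class_le:
  assumes "r > 0"
  shows "real (card {x \<in> {1..n}. x mod r = j}) \<le> real n / real r + 1"
proof -
  have "inj_on (\<lambda>x. x div r) {x \<in> {1..n}. x mod r = j}"
    by (rule inj_onI) (metis (mono_tags, lifting) div_mult_mod_eq mem_Collect_eq)
  moreover have "(\<lambda>x. x div r) ` {x \<in> {1..n}. x mod r = j} \<subseteq> {..n div r}"
    by (auto intro: div_le_mono)
  ultimately have "card {x \<in> {1..n}. x mod r = j} \<le> card {..n div r}"
    by (intro card_inj_on_le) auto
  then have "real (card {x \<in> {1..n}. x mod r = j}) \<le> real (n div r) + 1"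
    by simp
  then show ?thesis
    using of_nat_div_le_of_nat[of n r, where ?'a = real] by linarith
qed

lemma card_pairs_eq_label:
  assumes V: "finite V" and f: "f ` V \<subseteq> {..<r::nat}"
  shows "card (pairs V V (\<lambda>x y. f x = f y)) = (\<Sum>j<r. (card {x \<in> V. f x = j})\<^sup>2)"
proof -
  have eq: "pairs V V (\<lambda>x y. f x = f y) = (\<Union>j<r. {x \<in> V. f x = j} \<times> {x \<in> V. f x = j})"
    using f by (auto simp: pairs_def)
  show ?thesis
    unfolding eq by (subst card_UN_disjoint) (use V in \<open>auto simp: card_cartesian_product power2_eq_square\<close>)
qed

lemma sum_card_label:
  assumes V: "finite V" and f: "f ` V \<subseteq> {..<r::nat}"
  shows "(\<Sum>j<r. card {x \<in> V. f x = j}) = card V"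
proof -
  have eq: "V = (\<Union>j<r. {x \<in> V. f x = j})"
    using f by auto
  show ?thesis
    by (subst (2) eq, subst card_UN_disjoint) (use V in auto)
qed

lemma card_pairs_compl:
  assumes "finite A" "finite B"
  shows "card (pairs A B P) = card (pairs A B (\<lambda>x y. P x y \<and> Q x y)) + card (pairs A B (\<lambda>x y. P x y \<and> \<not> Q x y))"
proof -
  have eq: "pairs A B P = pairs A B (\<lambda>x y. P x y \<and> Q x y) \<union> pairs A B (\<lambda>x y. P x y \<and> \<not> Q x y)"
    by (auto simp: pairs_def)
  show ?thesis
    by (subst eq, rule card_Un_disjoint) (use assms in \<open>auto intro: finite_pairs\<close>, auto simp: pairs_def)
qed

text \<open>The error has three sources: edges inside classes, missing pairs between classes, and
  vertices that must change class to match the residue classes. Near-extremality bounds the first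
  two by \<open>5 * \<beta>\<close> and, through the variance of the class sizes, the third by
  \<open>sqrt (2 * \<beta>)\<close> per class; the linear term comes from rounding
  \<open>n / r\<close>.\<close>

lemma edit_distance_turan_le:
  fixes G :: "nat sgraph" and \<beta> :: real
  assumes r: "r > 0" and \<beta>: "\<beta> \<ge> 0" and vG: "verts G = {1..n}" and eG: "edges G \<subseteq> nsets {1..n} 2"
    and f: "f ` {1..n} \<subseteq> {..<r}"
    and adj: "adj = (\<lambda>x y. {x, y} \<in> edges G)"
    and lower: "real (card (pairs {1..n} {1..n} adj)) \<ge> (1 - 1 / real r) * (real n)\<^sup>2 - \<beta> * (real n)\<^sup>2"
    and part: "real (card (pairs {1..n} {1..n} adj)) + real (card (pairs {1..n} {1..n} (\<lambda>x y. adj x y \<and> f x = f y)))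
        \<le> real (card (pairs {1..n} {1..n} (\<lambda>x y. f x \<noteq> f y))) + \<beta> * (real n)\<^sup>2"
  shows "real (edit_distance G (turan_graph n r)) \<le> (5 * \<beta> + real r * sqrt (2 * \<beta>)) * (real n)\<^sup>2 + real r * real n"
proof -
  define V where "V = {1..n}"
  have V: "finite V" "card V = n"
    unfolding V_def by auto
  define E where "E = real (card (pairs V V adj))"
  define In where "In = real (card (pairs V V (\<lambda>x y. adj x y \<and> f x = f y)))"
  define P where "P = real (card (pairs V V (\<lambda>x y. f x \<noteq> f y)))"
  define Y where "Y = real (card (pairs V V (\<lambda>x y. f x \<noteq> f y \<and> \<not> adj x y)))"
  define N where "N = (real n)\<^sup>2"
  define q where "q = (1 - 1 / real r) * N"
  have lower': "E \<ge> q - \<beta> * N" and part': "E + In \<le> P + \<beta> * N"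
    using lower part unfolding E_def In_def P_def V_def N_def q_def by auto
  have "card (pairs V V adj) = card (pairs V V (\<lambda>x y. adj x y \<and> f x = f y)) + card (pairs V V (\<lambda>x y. adj x y \<and> f x \<noteq> f y))"
    by (rule card_pairs_compl[OF V(1) V(1)])
  moreover have "card (pairs V V (\<lambda>x y. f x \<noteq> f y)) = card (pairs V V (\<lambda>x y. f x \<noteq> f y \<and> adj x y)) + card (pairs V V (\<lambda>x y. f x \<noteq> f y \<and> \<not> adj x y))"
    by (rule card_pairs_compl[OF V(1) V(1)])
  moreover have "(\<lambda>x y. f x \<noteq> f y \<and> adj x y) = (\<lambda>x y. adj x y \<and> f x \<noteq> f y)"
    by auto
  ultimately have Y: "Y = P - (E - In)"
    unfolding Y_def P_def E_def In_def by simp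
  define c where "c j = real (card {x \<in> V. f x = j})" for j
  define m where "m = real n / real r"
  have "card (pairs V V (\<lambda>_ _. True)) = card (pairs V V (\<lambda>x y. True \<and> f x = f y)) + card (pairs V V (\<lambda>x y. True \<and> f x \<noteq> f y))"
    by (rule card_pairs_compl[OF V(1) V(1)])
  then have "real (card V * card V) = real (card (pairs V V (\<lambda>x y. f x = f y))) + P"
    by (simp add: card_pairs_True P_def)
  also have "real (card (pairs V V (\<lambda>x y. f x = f y))) = (\<Sum>j<r. (c j)\<^sup>2)"
    unfolding c_def using card_pairs_eq_label[of V f r] V f by (simp add: V_def)
  finally have P: "P = N - (\<Sum>j<r. (c j)\<^sup>2)"
    using V by (simp add: N_def power2_eq_square)
  have sc: "(\<Sum>j<r. c j) = real n"
    unfolding c_def using sum_card_label[of V f r] V f by (simp add: V_def flip: of_nat_sum)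
  \<comment> \<open>Expanding around the mean \<open>m\<close> identifies the Turan defect
    \<open>q - P\<close> with the sum of squared deviations; this is the convexity behind
    \<open>P \<le> q\<close>.\<close>
  have "(\<Sum>j<r. (c j - m)\<^sup>2) = (\<Sum>j<r. (c j)\<^sup>2) - 2 * m * (\<Sum>j<r. c j) + real r * m\<^sup>2"
    by (simp add: power2_diff sum.distrib sum_subtractf sum_distrib_left mult.commute mult.left_commute)
  also have "\<dots> = (\<Sum>j<r. (c j)\<^sup>2) - N / real r"
    unfolding sc m_def N_def using r by (simp add: power2_eq_square field_simps)
  also have "\<dots> = q - P"
    unfolding P q_def by (simp add: algebra_simps)
  finally have dev: "(\<Sum>j<r. (c j - m)\<^sup>2) = q - P" .
  then have Pq: "P \<le> q"
    using sum_nonneg[of "{..<r}" "\<lambda>j. (c j - m)\<^sup>2"] by simp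
  have In0: "In \<ge> 0" unfolding In_def by simp
  \<comment> \<open>Here \<open>P - E \<le> \<beta> * N\<close>, hence
    \<open>In \<le> 2 * \<beta> * N\<close>; as \<open>Y = (P - E) + In\<close>, also
    \<open>Y \<le> 3 * \<beta> * N\<close>, and 2 + 3 = 5.\<close>
  have D: "In + Y \<le> 5 * \<beta> * N"
    using lower' part' Pq Y by (simp add: algebra_simps)
  have cm: "m - c j \<le> sqrt (2 * \<beta>) * real n" if "j < r" for j
  proof -
    have "(c j - m)\<^sup>2 \<le> (\<Sum>j<r. (c j - m)\<^sup>2)"
      by (rule member_le_sum) (use that in auto)
    also have "\<dots> \<le> 2 * \<beta> * N"
      using dev lower' part' In0 by simp
    finally have "sqrt ((c j - m)\<^sup>2) \<le> sqrt (2 * \<beta> * N)"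
      by (rule real_sqrt_le_mono)
    then have "\<bar>c j - m\<bar> \<le> sqrt (2 * \<beta>) * real n"
      unfolding N_def real_sqrt_mult by simp
    then show ?thesis by linarith
  qed
  define g where "g x = x mod r" for x :: nat
  have g: "g ` V \<subseteq> {..<r}"
    using r by (auto simp: g_def)
  obtain \<sigma> where \<sigma>: "bij_betw \<sigma> V V" and bad: "card {x \<in> V. f (\<sigma> x) \<noteq> g x}
    \<le> (\<Sum>j<r. card {x \<in> V. g x = j} - card {x \<in> V. f x = j})"
    using bij_matching_labels[of V "{..<r}" f g] V(1) f g by (auto simp: V_def)
  define B where "B = {x \<in> V. f (\<sigma> x) \<noteq> g x}"
  have "real (card B) \<le> (\<Sum>j<r. real (card {x \<in> V. g x = j} - card {x \<in> V. f x = j}))"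
    using bad unfolding B_def by (simp flip: of_nat_sum)
  also have "\<dots> \<le> (\<Sum>j<r. sqrt (2 * \<beta>) * real n + 1)"
  proof (rule sum_mono)
    fix j assume j: "j \<in> {..<r}"
    have "real (card {x \<in> V. g x = j}) \<le> m + 1"
      using card_residue_class_le[OF r, of n j] by (simp add: V_def g_def m_def)
    moreover have "m - c j \<le> sqrt (2 * \<beta>) * real n"
      using cm j by simp
    moreover have "0 \<le> sqrt (2 * \<beta>) * real n"
      using \<beta> by simp
    ultimately show "real (card {x \<in> V. g x = j} - card {x \<in> V. f x = j}) \<le> sqrt (2 * \<beta>) * real n + 1"
      unfolding c_def by linarith
  qed
  also have "\<dots> = real r * (sqrt (2 * \<beta>) * real n + 1)"
    by simp
  finally have B: "real (card B) \<le> real r * (sqrt (2 * \<beta>) * real n + 1)" .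
  \<comment> \<open>Away from the image of \<open>B\<close> the relabelled Turan graph joins two
    vertices exactly when \<open>f\<close> separates them, so the only discrepancies there are
    counted by \<open>In\<close> and \<open>Y\<close>. All pairs meeting the image of
    \<open>B\<close> are given up.\<close>
  define X where "X = pairs V V (\<lambda>x y. adj x y \<and> f x = f y) \<union> pairs V V (\<lambda>x y. f x \<noteq> f y \<and> \<not> adj x y)
    \<union> (\<sigma> ` B \<times> V)"
  have \<sigma>V: "\<sigma> x \<in> V" if "x \<in> V" for x
    using \<sigma> that by (auto simp: bij_betw_def)
  have finB: "finite B"
    unfolding B_def using V by simp
  have finX: "finite X"
    unfolding X_def using V finB by (simp add: finite_pairs)
  define T where "T = (\<lambda>e. \<sigma> ` e) ` edges (turan_graph n r)"
  have T_iff: "{x, y} \<in> T \<longleftrightarrow> f x \<noteq> f y" if xy: "x \<in> V" "y \<in> V" "x \<notin> \<sigma> ` B" "y \<notin> \<sigma> ` B" for x y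
  proof -
    have "x \<in> \<sigma> ` V" "y \<in> \<sigma> ` V"
      using xy bij_betw_imp_surj_on[OF \<sigma>] by simp_all
    then obtain a b where ab: "x = \<sigma> a" "y = \<sigma> b" "a \<in> V" "b \<in> V"
      by blast
    then have fg: "f x = g a" "f y = g b"
      using xy by (auto simp: B_def)
    have inj: "\<sigma> u = \<sigma> v \<longleftrightarrow> u = v" if "u \<in> V" "v \<in> V" for u v
      using \<sigma> that by (auto simp: bij_betw_def inj_on_def)
    show ?thesis
    proof
      assume "{x, y} \<in> T"
      then obtain u v where uv: "{x, y} = {\<sigma> u, \<sigma> v}" "u \<in> V" "v \<in> V" "g u \<noteq> g v"
        unfolding T_def turan_graph_def by (auto simp: V_def g_def)
      then show "f x \<noteq> f y"
        using fg ab inj by (auto simp: doubleton_eq_iff)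
    next
      assume "f x \<noteq> f y"
      then have "{a, b} \<in> edges (turan_graph n r)"
        using fg ab unfolding turan_graph_def by (auto simp: V_def g_def)
      then have "\<sigma> ` {a, b} \<in> T"
        unfolding T_def by (rule imageI)
      then show "{x, y} \<in> T"
        using ab by simp
    qed
  qed
  have "sym_diff (edges G) T \<subseteq> (\<lambda>(x, y). {x, y}) ` X"
  proof
    fix e assume e: "e \<in> sym_diff (edges G) T"
    then have "\<exists>x y. e = {x, y} \<and> x \<in> V \<and> y \<in> V"
    proof
      assume "e \<in> edges G - T"
      then have "e \<in> nsets V 2"
        using eG by (auto simp: V_def)
      then show ?thesis
        by (elim nsets2_E) auto
    next
      assume "e \<in> T - edges G"
      then obtain d where d: "d \<in> edges (turan_graph n r)" "e = \<sigma> ` d"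
        unfolding T_def by blast
      then obtain a b where "d = {a, b}" "a \<in> V" "b \<in> V"
        unfolding turan_graph_def V_def by auto
      then show ?thesis
        using d(2) \<sigma>V by (intro exI[of _ "\<sigma> a"] exI[of _ "\<sigma> b"]) simp
    qed
    then obtain x y where xy: "e = {x, y}" "x \<in> V" "y \<in> V"
      by blast
    consider "x \<in> \<sigma> ` B" | "y \<in> \<sigma> ` B" | "x \<notin> \<sigma> ` B" "y \<notin> \<sigma> ` B"
      by blast
    then show "e \<in> (\<lambda>(x, y). {x, y}) ` X"
    proof cases
      case 1
      then have "(x, y) \<in> X"
        using xy unfolding X_def by blast
      then show ?thesis using xy by force
    next
      case 2
      then have "(y, x) \<in> X"
        using xy unfolding X_def by blast
      then show ?thesis using xy by (force simp: insert_commute)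
    next
      case 3
      then have "(x, y) \<in> X"
        using e xy T_iff[OF xy(2,3) 3] unfolding X_def pairs_def adj by auto
      then show ?thesis using xy by force
    qed
  qed
  then have "card (sym_diff (edges G) T) \<le> card X"
    by (rule surj_card_le[OF finX])
  also have "\<dots> \<le> card (pairs V V (\<lambda>x y. adj x y \<and> f x = f y)) + card (pairs V V (\<lambda>x y. f x \<noteq> f y \<and> \<not> adj x y))
    + card (\<sigma> ` B \<times> V)"
    unfolding X_def by (meson add_le_mono1 card_Un_le le_trans)
  also have "\<dots> \<le> card (pairs V V (\<lambda>x y. adj x y \<and> f x = f y)) + card (pairs V V (\<lambda>x y. f x \<noteq> f y \<and> \<not> adj x y))
    + card B * n"
    using card_image_le[OF finB, of \<sigma>] V by (simp add: card_cartesian_product)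
  finally have sd: "real (card (sym_diff (edges G) T)) \<le> In + Y + real (card B) * real n"
    unfolding In_def Y_def by (simp flip: of_nat_add of_nat_mult)
  have "edit_distance G (turan_graph n r) \<le> card (sym_diff (edges G) T)"
    unfolding T_def
  proof (rule edit_distance_le)
    show "edges G \<subseteq> Pow (verts G)"
      using eG vG by (auto simp: nsets_def)
    show "finite (verts G)"
      by (simp add: vG)
    show "edges (turan_graph n r) \<subseteq> Pow (verts (turan_graph n r))"
      unfolding turan_graph_def by auto
    show "bij_betw \<sigma> (verts (turan_graph n r)) (verts G)"
      using \<sigma> by (simp add: vG turan_graph_def V_def)
  qed
  then have "real (edit_distance G (turan_graph n r)) \<le> real (card (sym_diff (edges G) T))"
    by (simp only: of_nat_le_iff)
  then have "real (edit_distance G (turan_graph n r)) \<le> In + Y + real (card B) * real n"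
    using sd by (rule order_trans)
  also have "\<dots> \<le> 5 * \<beta> * N + real r * (sqrt (2 * \<beta>) * real n + 1) * real n"
    using D B by (intro add_mono mult_right_mono) auto
  also have "\<dots> = (5 * \<beta> + real r * sqrt (2 * \<beta>)) * (real n)\<^sup>2 + real r * real n"
    by (simp add: N_def power2_eq_square algebra_simps)
  finally show ?thesis .
qed

text \<open>Every edge occurs once as an increasing and once as a decreasing pair.\<close>

lemma two_card_edges_le:
  fixes G :: "nat sgraph"
  assumes "edges G \<subseteq> nsets V 2" "finite V"
  shows "2 * card (edges G) \<le> card (pairs V V (\<lambda>x y. {x, y} \<in> edges G))"
proof -
  define A where "A = pairs V V (\<lambda>x y. {x, y} \<in> edges G \<and> x < y)"
  define A' where "A' = pairs V V (\<lambda>x y. {x, y} \<in> edges G \<and> y < x)"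
  have fin: "finite A" "finite A'"
    unfolding A_def A'_def using assms(2) by (simp_all add: finite_pairs)
  have "edges G \<subseteq> (\<lambda>(x, y). {x, y}) ` A"
  proof
    fix e assume e: "e \<in> edges G"
    then obtain x y where "e = {x, y}" "x \<in> V" "y \<in> V" "x < y"
      using assms(1) by (auto simp: ordered_nsets_2_eq)
    then have "(x, y) \<in> A" "e = (\<lambda>(x, y). {x, y}) (x, y)"
      using e by (auto simp: A_def pairs_def)
    then show "e \<in> (\<lambda>(x, y). {x, y}) ` A"
      by (rule rev_image_eqI)
  qed
  then have "card (edges G) \<le> card A"
    by (rule surj_card_le[OF fin(1)])
  moreover have "card A = card A'"
    unfolding A_def A'_def by (subst card_pairs_swap) (simp add: insert_commute)
  moreover have "card A + card A' = card (A \<union> A')"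
    using fin by (intro card_Un_disjoint[symmetric]) (auto simp: A_def A'_def pairs_def)
  moreover have "card (A \<union> A') \<le> card (pairs V V (\<lambda>x y. {x, y} \<in> edges G))"
    by (rule card_mono[OF finite_pairs]) (use assms(2) in \<open>auto simp: A_def A'_def pairs_def\<close>)
  ultimately show ?thesis by linarith
qed

section \<open>Choice of the constants and conclusion\<close>

theorem theorem1p6:
  fixes k :: nat and H :: "nat \<Rightarrow> 'a sgraph" and \<epsilon> :: real
  assumes "k \<ge> 1"
    and "\<And>i. i \<in> {1..k} \<Longrightarrow> finite_simple_graph (H i)"
    and "\<And>i. i \<in> {1..k} \<Longrightarrow> \<not> bipartite (H i)"
    and "\<epsilon> > 0"
  shows "\<exists>\<delta>::real. \<delta> > 0 \<and>
    (\<forall>\<^sub>F n in sequentially. \<forall>\<phi>. edge_colouring n k \<phi> \<longrightarrow>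
       real (nim n k H \<phi>) \<ge> (1 - 1 / real (r_star k H)) * (real n)\<^sup>2 / 2 - \<delta> * (real n)\<^sup>2 \<longrightarrow>
       real (edit_distance (nim_graph n k H \<phi>) (turan_graph n (r_star k H))) \<le> \<epsilon> * (real n)\<^sup>2)"
proof -
  define r where "r = r_star k H"
  have ne: "edges (H i) \<noteq> {}" if "i \<in> {1..k}" for i
    using edges_nonempty_if_not_bipartite assms(3) that by blast
  have r: "r \<ge> 1"
    unfolding r_def by (rule r_star_pos[where H = H, OF assms(1,2) ne])
  \<comment> \<open>\<gamma> is the value of \<open>sqrt (2 * \<beta>)\<close>, which forces
    \<open>\<beta> = \<gamma>^2 / 2\<close>. As \<open>\<gamma> \<le> 1\<close>, the term
    \<open>5 * \<beta>\<close> is at most \<open>3 * \<gamma>\<close>, so the quadratic error is at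
    most \<open>(r + 3) * \<gamma> \<le> \<epsilon> / 2\<close>. The other half of \<epsilon>
    absorbs the linear term \<open>r * n\<close> once
    \<open>n \<ge> 2 * r / \<epsilon>\<close>.\<close>
  define \<gamma> where "\<gamma> = min 1 (\<epsilon> / (2 * (real r + 3)))"
  have \<gamma>: "\<gamma> > 0" "\<gamma> \<le> 1"
    using \<open>\<epsilon> > 0\<close> by (auto simp: \<gamma>_def)
  have "(real r + 3) * \<gamma> \<le> (real r + 3) * (\<epsilon> / (2 * (real r + 3)))"
    unfolding \<gamma>_def by (intro mult_left_mono) auto
  also have "\<dots> = \<epsilon> / 2"
    by (simp add: divide_simps)
  finally have \<gamma>r: "(real r + 3) * \<gamma> \<le> \<epsilon> / 2" .
  define \<beta> where "\<beta> = \<gamma>\<^sup>2 / 2"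
  have "\<beta> > 0"
    unfolding \<beta>_def using \<gamma> by simp
  \<comment> \<open>The partition lemma applied to \<open>r - 1\<close> uses the labels
    \<open>{..r - 1}\<close>, that is \<open>r\<close> classes, and concerns cliques of size
    \<open>r - 1 + 2\<close>.\<close>
  define m where "m = r - 1 + 2"
  have m: "m = Suc r"
    unfolding m_def using r by simp
  obtain \<eta> :: real where "\<eta> > 0" and \<eta>: "\<forall>n (V :: nat set) adj. symp adj \<longrightarrow> finite V \<longrightarrow> card V \<le> n \<longrightarrow>
    real (card (cliques adj V m)) \<le> \<eta> * real n ^ m \<longrightarrow>
    (\<exists>f. f ` V \<subseteq> {..r - 1} \<and>
      real (card (pairs V V adj)) + real (card (pairs V V (\<lambda>x y. adj x y \<and> f x = f y)))
        \<le> real (card (pairs V V (\<lambda>x y. f x \<noteq> f y))) + \<beta> * (real n)\<^sup>2)"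
    using partition_if_few_cliques[OF \<open>\<beta> > 0\<close>, where r = "r - 1" and 'v = nat, folded m_def] by (elim exE conjE) (rule that)
  obtain M where M: "\<forall>n \<phi> As. edge_colouring n k \<phi> \<longrightarrow> length As = m \<longrightarrow>
    (\<forall>A\<in>set As. A \<subseteq> {1..n} \<and> card A = M) \<longrightarrow>
    listset As \<subseteq> cliques (\<lambda>x y. nim_edge n k H \<phi> {x, y}) {1..n} m \<longrightarrow> (\<exists>\<xi>. feasible m k H \<xi>)"
    using feasible_if_nim_multipartite[where H = H and s = m, OF assms(1,2) ne]
    by (elim meta_impE exE) (simp, simp, rule that)
  obtain n0 where n0: "\<forall>n\<ge>n0. \<forall>(V :: nat set) R. finite V \<longrightarrow> card V \<le> n \<longrightarrow>
    R \<subseteq> {xs. set xs \<subseteq> V \<and> length xs = m} \<longrightarrow> \<eta> * real n ^ m \<le> real (card R) \<longrightarrow>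
    (\<exists>As. length As = m \<and> (\<forall>A\<in>set As. A \<subseteq> V \<and> card A = M) \<and> listset As \<subseteq> R)"
    using box_in_dense_relation[OF \<open>\<eta> > 0\<close>, where m = m and M = M and 'v = nat] by (elim exE) (rule that)
  define n1 where "n1 = max n0 (nat \<lceil>2 * real r / \<epsilon>\<rceil>)"
  have main: "real (edit_distance (nim_graph n k H \<phi>) (turan_graph n r)) \<le> \<epsilon> * (real n)\<^sup>2"
    if n: "n \<ge> n1" and col: "edge_colouring n k \<phi>"
      and nim: "real (nim n k H \<phi>) \<ge> (1 - 1 / real r) * (real n)\<^sup>2 / 2 - \<beta> / 2 * (real n)\<^sup>2" for n \<phi>
  proof -
    define G where "G = nim_graph n k H \<phi>"
    define adj where "adj x y \<longleftrightarrow> {x, y} \<in> edges G" for x y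
    have adj_eq: "adj = (\<lambda>x y. nim_edge n k H \<phi> {x, y})"
      by (simp add: fun_eq_iff adj_def G_def nim_graph_def)
    have vG: "verts G = {1..n}" and eG: "edges G \<subseteq> nsets {1..n} 2"
      by (auto simp: G_def nim_graph_def nim_edge_def complete_graph_def)
    have nr: "n0 \<le> n" "2 * real r / \<epsilon> \<le> real n"
      using n unfolding n1_def by linarith+
    have few: "real (card (cliques adj {1..n} m)) \<le> \<eta> * real n ^ m"
    proof (rule ccontr)
      assume "\<not> ?thesis"
      then have "\<exists>As. length As = m \<and> (\<forall>A\<in>set As. A \<subseteq> {1..n} \<and> card A = M) \<and> listset As \<subseteq> cliques adj {1..n} m"
        by (intro n0[rule_format, OF nr(1)]) (auto simp: cliques_def)
      then obtain As where As: "length As = m" "\<forall>A\<in>set As. A \<subseteq> {1..n} \<and> card A = M"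
          "listset As \<subseteq> cliques adj {1..n} m"
        by (elim exE conjE) (rule that)
      then have "\<exists>\<xi>. feasible m k H \<xi>"
        using M[THEN spec, THEN spec, THEN spec, THEN mp, OF col, of As] unfolding adj_eq by simp
      then obtain \<xi> where "feasible m k H \<xi>"
        by blast
      then have "m \<le> r"
        unfolding r_def using feasible_le_r_star[of k H] assms(1,2) by blast
      then show False
        using m by simp
    qed
    have "symp adj"
      by (auto simp: symp_def adj_def insert_commute)
    then obtain f where f: "f ` {1..n} \<subseteq> {..r - 1}" and part:
      "real (card (pairs {1..n} {1..n} adj)) + real (card (pairs {1..n} {1..n} (\<lambda>x y. adj x y \<and> f x = f y)))
        \<le> real (card (pairs {1..n} {1..n} (\<lambda>x y. f x \<noteq> f y))) + \<beta> * (real n)\<^sup>2"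
      using \<eta>[rule_format, OF _ _ _ few] by auto
    have "2 * card (edges G) \<le> card (pairs {1..n} {1..n} adj)"
      unfolding adj_def using two_card_edges_le[OF eG] by simp
    moreover have "card (edges G) = nim n k H \<phi>"
      by (simp add: G_def nim_graph_def nim_def)
    ultimately have E: "2 * real (nim n k H \<phi>) \<le> real (card (pairs {1..n} {1..n} adj))"
      by linarith
    have "(1 - 1 / real r) * (real n)\<^sup>2 - \<beta> * (real n)\<^sup>2
      = 2 * ((1 - 1 / real r) * (real n)\<^sup>2 / 2 - \<beta> / 2 * (real n)\<^sup>2)"
      by (simp add: algebra_simps)
    also have "\<dots> \<le> 2 * real (nim n k H \<phi>)"
      using nim by (intro mult_left_mono) auto
    also note E
    finally have lower: "real (card (pairs {1..n} {1..n} adj)) \<ge> (1 - 1 / real r) * (real n)\<^sup>2 - \<beta> * (real n)\<^sup>2" .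
    have f': "f ` {1..n} \<subseteq> {..<r}"
      using f r by force
    have "adj = (\<lambda>x y. {x, y} \<in> edges G)"
      by (simp add: fun_eq_iff adj_def)
    then have "real (edit_distance G (turan_graph n r))
      \<le> (5 * \<beta> + real r * sqrt (2 * \<beta>)) * (real n)\<^sup>2 + real r * real n"
      using r \<open>\<beta> > 0\<close> by (intro edit_distance_turan_le[OF _ _ vG eG f' _ lower part]) auto
    also have "sqrt (2 * \<beta>) = \<gamma>"
      using \<gamma> by (simp add: \<beta>_def)
    also have "(5 * \<beta> + real r * \<gamma>) * (real n)\<^sup>2 + real r * real n \<le> \<epsilon> / 2 * (real n)\<^sup>2 + \<epsilon> / 2 * (real n)\<^sup>2"
    proof (intro add_mono mult_right_mono)
      have "\<gamma>\<^sup>2 \<le> \<gamma>"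
        using \<gamma> by (simp add: power2_eq_square mult_left_le)
      then have "5 * \<beta> \<le> 3 * \<gamma>"
        using \<gamma> unfolding \<beta>_def by simp
      then show "5 * \<beta> + real r * \<gamma> \<le> \<epsilon> / 2"
        using \<gamma>r by (simp add: algebra_simps)
      have "real r \<le> \<epsilon> / 2 * real n"
        using nr(2) \<open>\<epsilon> > 0\<close> by (simp add: field_simps)
      then have "real r * real n \<le> (\<epsilon> / 2 * real n) * real n"
        by (rule mult_right_mono) simp
      then show "real r * real n \<le> \<epsilon> / 2 * (real n)\<^sup>2"
        by (simp add: power2_eq_square)
    qed simp
    finally show ?thesis
      by (simp add: G_def)
  qed
  show ?thesis
    unfolding r_def[symmetric]
  \<comment> \<open>Passing from edges to ordered pairs doubles the allowed deficit, so
    \<open>\<beta> / 2\<close> here becomes \<beta> there.\<close>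
  proof (intro exI[of _ "\<beta> / 2"] conjI)
    show "\<beta> / 2 > 0" using \<open>\<beta> > 0\<close> by simp
    show "\<forall>\<^sub>F n in sequentially. \<forall>\<phi>. edge_colouring n k \<phi> \<longrightarrow>
       real (nim n k H \<phi>) \<ge> (1 - 1 / real r) * (real n)\<^sup>2 / 2 - \<beta> / 2 * (real n)\<^sup>2 \<longrightarrow>
       real (edit_distance (nim_graph n k H \<phi>) (turan_graph n r)) \<le> \<epsilon> * (real n)\<^sup>2"
      using eventually_ge_at_top[of n1] by eventually_elim (intro allI impI main)
  qed
qed

end
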